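(* Let $n\ge2$, $k\ge3$, $\varepsilon>0$, and let $f:S_k^n\to[k]$ be a social choice function with $\mathbf{D}(f,\overline{\mathrm{NONMANIP}})\ge\varepsilon$. Let $\sigma\in S_k^n$ be uniformly random. Then $$\mathbb{P}(\sigma\in M(f))\ge\frac{\varepsilon^5}{4n^7k^{12}(k!)^4}.$$ Moreover, if $\sigma'$ is obtained from $\sigma$ by choosing a coordinate $i\in[n]$ uniformly at random and replacing $\sigma_i$ by an independent uniformly random ranking in $S_k$, then $$\mathbb{P}\big((\sigma,\sigma')\text{ is a manipulation pair for }f\big)\ge\frac{\varepsilon^5}{4n^8k^{12}(k!)^5}.$$
   Context: $[k]=\{1,\dots,k\}$, $S_k$ is the set of total orderings of $[k]$, a social choice function is a map $f:S_k^n\to[k]$. Write $a\overset{\sigma_i}{>}b$ if $\sigma_i$ ranks $a$ above $b$. $(\sigma,\sigma')$ is a manipulation pair for $f$ if $\sigma,\sigma'$ differ only in some coordinate $i$ and $f(\sigma')\overset{\sigma_i}{>}f(\sigma)$; $\sigma$ is then a manipulation point, and $M(f)$ is the set of manipulation points. $\overline{\mathrm{NONMANIP}}$ is the set of SCFs $f:S_k^n\to[k]$ that depend on only one coordinate or take at most two values. $\mathbf{D}(f,g)=\mathbb{P}(f(\sigma)\ne g(\sigma))$ for uniform $\sigma$, and $\mathbf{D}(f,G)=\min_{g\in G}\mathbf{D}(f,g)$. *)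

theory Defs
  imports "HOL-Probability.Probability"
begin

text \<open>
  An ordering of \<open>{1..k}\<close> is the reflexive relation of a linear order, where \<open>(b, a) \<in> r\<close> is
  read ``\<open>r\<close> ranks \<open>a\<close> at least as high as \<open>b\<close>''.
\<close>

definition rankings :: "nat \<Rightarrow> nat rel set" where
  "rankings k = {r. linear_order_on {1..k} r}"

definition ranks_above :: "nat rel \<Rightarrow> nat \<Rightarrow> nat \<Rightarrow> bool" where
  "ranks_above r a b \<longleftrightarrow> a \<noteq> b \<and> (b, a) \<in> r"

definition profiles :: "nat \<Rightarrow> nat \<Rightarrow> (nat \<Rightarrow> nat rel) set" where
  "profiles n k = {1..n} \<rightarrow>\<^sub>E rankings k"

text \<open>
  Profiles and social choice functions are taken extensional (\<open>undefined\<close> off their domain), so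
  that these sets are finite and in bijection with the mathematical ones.
\<close>

definition SCF :: "nat \<Rightarrow> nat \<Rightarrow> ((nat \<Rightarrow> nat rel) \<Rightarrow> nat) set" where
  "SCF n k = profiles n k \<rightarrow>\<^sub>E {1..k}"

definition manipulation_pair ::
    "nat \<Rightarrow> nat \<Rightarrow> ((nat \<Rightarrow> nat rel) \<Rightarrow> nat) \<Rightarrow> (nat \<Rightarrow> nat rel) \<Rightarrow> (nat \<Rightarrow> nat rel) \<Rightarrow> bool" where
  "manipulation_pair n k f \<sigma> \<sigma>' \<longleftrightarrow>
     \<sigma> \<in> profiles n k \<and> \<sigma>' \<in> profiles n k \<and>
     (\<exists>i\<in>{1..n}. (\<forall>j\<in>{1..n}. \<sigma> j \<noteq> \<sigma>' j \<longleftrightarrow> j = i) \<and> ranks_above (\<sigma> i) (f \<sigma>') (f \<sigma>))"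

definition manipulation_points ::
    "nat \<Rightarrow> nat \<Rightarrow> ((nat \<Rightarrow> nat rel) \<Rightarrow> nat) \<Rightarrow> (nat \<Rightarrow> nat rel) set" where
  "manipulation_points n k f = {\<sigma>. \<exists>\<sigma>'. manipulation_pair n k f \<sigma> \<sigma>'}"

definition depends_on_one_coordinate ::
    "nat \<Rightarrow> nat \<Rightarrow> ((nat \<Rightarrow> nat rel) \<Rightarrow> nat) \<Rightarrow> bool" where
  "depends_on_one_coordinate n k f \<longleftrightarrow>
     (\<exists>i\<in>{1..n}. \<forall>\<sigma>\<in>profiles n k. \<forall>\<tau>\<in>profiles n k. \<sigma> i = \<tau> i \<longrightarrow> f \<sigma> = f \<tau>)"

definition NONMANIP_bar :: "nat \<Rightarrow> nat \<Rightarrow> ((nat \<Rightarrow> nat rel) \<Rightarrow> nat) set" where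
  "NONMANIP_bar n k =
     {f \<in> SCF n k. depends_on_one_coordinate n k f \<or> card (f ` profiles n k) \<le> 2}"

definition uniform_profile :: "nat \<Rightarrow> nat \<Rightarrow> (nat \<Rightarrow> nat rel) pmf" where
  "uniform_profile n k = pmf_of_set (profiles n k)"

definition SCF_dist ::
    "nat \<Rightarrow> nat \<Rightarrow> ((nat \<Rightarrow> nat rel) \<Rightarrow> nat) \<Rightarrow> ((nat \<Rightarrow> nat rel) \<Rightarrow> nat) \<Rightarrow> real" where
  "SCF_dist n k f g = measure_pmf.prob (uniform_profile n k) {\<sigma>. f \<sigma> \<noteq> g \<sigma>}"

definition SCF_dist_set ::
    "nat \<Rightarrow> nat \<Rightarrow> ((nat \<Rightarrow> nat rel) \<Rightarrow> nat) \<Rightarrow> ((nat \<Rightarrow> nat rel) \<Rightarrow> nat) set \<Rightarrow> real" where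
  "SCF_dist_set n k f G = Min (SCF_dist n k f ` G)"

definition rerandomized_pair ::
    "nat \<Rightarrow> nat \<Rightarrow> ((nat \<Rightarrow> nat rel) \<times> (nat \<Rightarrow> nat rel)) pmf" where
  "rerandomized_pair n k = do {
     \<sigma> \<leftarrow> uniform_profile n k;
     i \<leftarrow> pmf_of_set {1..n};
     r \<leftarrow> pmf_of_set (rankings k);
     return_pmf (\<sigma>, \<sigma>(i := r))
   }"

text \<open>
  The arguments of \<open>pmf_of_set\<close> and \<open>Min\<close> above are finite and nonempty, as these require.
\<close>

lemma finite_rankings: "finite (rankings k)"
proof -
  have "rankings k \<subseteq> Pow ({1..k} \<times> {1..k})"
    by (auto simp: rankings_def order_on_defs)
  then show ?thesis
    by (rule finite_subset) simp
qed

lemma rankings_nonempty: "rankings k \<noteq> {}"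
proof -
  have "{(a, b). a \<in> {1..k} \<and> b \<in> {1..k} \<and> a \<le> b} \<in> rankings k"
    by (auto simp: rankings_def order_on_defs refl_on_def trans_def antisym_def total_on_def)
  then show ?thesis
    by blast
qed

lemma finite_profiles: "finite (profiles n k)"
  by (simp add: profiles_def finite_rankings finite_PiE)

lemma profiles_nonempty: "profiles n k \<noteq> {}"
  by (simp add: profiles_def PiE_eq_empty_iff rankings_nonempty)

lemma finite_NONMANIP_bar: "finite (NONMANIP_bar n k)"
  by (simp add: NONMANIP_bar_def SCF_def finite_PiE finite_profiles)

lemma NONMANIP_bar_nonempty:
  assumes "k \<ge> 1"
  shows "NONMANIP_bar n k \<noteq> {}"
proof -
  have "(\<lambda>\<sigma>\<in>profiles n k. 1) ` profiles n k \<subseteq> {1 :: nat}"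
    by auto
  then have "card ((\<lambda>\<sigma>\<in>profiles n k. 1 :: nat) ` profiles n k) \<le> card {1 :: nat}"
    by (intro card_mono) auto
  then have "(\<lambda>\<sigma>\<in>profiles n k. 1) \<in> NONMANIP_bar n k"
    using assms by (auto simp: NONMANIP_bar_def SCF_def)
  then show ?thesis
    by blast
qed

end

theory Submission
  imports Defs
begin

text \<open>
  Call a profile pivotal for voter \<open>i\<close> and a pair \<open>X\<close> of alternatives if voter \<open>i\<close> alone can
  make \<open>f\<close> take both values in \<open>X\<close>. Resampling the coordinates one at a time shows that an \<open>f\<close>
  far from the dictatorial and the two-valued functions has two voters \<open>i \<noteq> j\<close> and two pairs
  \<open>X \<noteq> Y\<close> for which the pivotal sets \<open>U\<close> and \<open>V\<close> are large.

  Fix all voters but \<open>i\<close> and some \<open>l\<close>. If the resulting two-voter rule has no manipulation, then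
  by the two-voter Gibbard--Satterthwaite theorem \<open>U\<close> is stable under changes of \<open>l\<close>'s ranking
  that keep the order of the two alternatives in \<open>X\<close>, and \<open>U\<close> and \<open>V\<close> cannot meet when \<open>l = j\<close>.
  So if there are few manipulation points, \<open>U\<close> is nearly a function of the votes on \<open>X\<close>, \<open>V\<close> is
  nearly a function of the votes on \<open>Y\<close>, and \<open>U \<inter> V\<close> is nearly empty. But for a uniform ranking
  the orders of \<open>X\<close> and \<open>Y\<close> have correlation at most \<open>1/3\<close> in absolute value, and sets determined
  by such correlated bits meet in probability at least \<open>P(A)\<^sup>2 P(B)\<^sup>2\<close> (reverse hypercontractivity).
\<close>

section \<open>Product spaces\<close>

text \<open>
  Walk from \<open>\<sigma>\<close> to \<open>\<tau>\<close> replacing one coordinate at a time. Each step of the walk is distributed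
  like the first one: swapping the coordinates already replaced between \<open>\<sigma>\<close> and \<open>\<tau>\<close> is an
  involution of the set of pairs.
\<close>
lemma resampling_bound:
  fixes \<phi> :: "('i \<Rightarrow> 'a) \<Rightarrow> 'c" and E :: "'i \<Rightarrow> 'a \<Rightarrow> 'a \<Rightarrow> bool" and W :: "'i \<Rightarrow> ('i \<Rightarrow> 'a) set"
  assumes fin: "finite I" "finite \<Omega>"
    and sym: "\<And>j x y. E j x y \<Longrightarrow> E j y x"
    and fib: "\<And>\<sigma>. \<sigma> \<in> I \<rightarrow>\<^sub>E \<Omega> \<Longrightarrow> card {\<tau> \<in> I \<rightarrow>\<^sub>E \<Omega>. \<forall>j\<in>I. E j (\<sigma> j) (\<tau> j)} = m"
    and W: "\<And>j \<sigma> \<tau>. \<lbrakk>j \<in> I; \<sigma> \<in> I \<rightarrow>\<^sub>E \<Omega>; \<tau> \<in> I \<rightarrow>\<^sub>E \<Omega>; \<forall>j\<in>I. E j (\<sigma> j) (\<tau> j);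
      \<phi> \<sigma> \<noteq> \<phi> (\<sigma>(j := \<tau> j))\<rbrakk> \<Longrightarrow> \<sigma> \<in> W j"
    and W_sub: "\<And>j. j \<in> I \<Longrightarrow> W j \<subseteq> I \<rightarrow>\<^sub>E \<Omega>"
  shows "card {(\<sigma>, \<tau>). \<sigma> \<in> I \<rightarrow>\<^sub>E \<Omega> \<and> \<tau> \<in> I \<rightarrow>\<^sub>E \<Omega> \<and> (\<forall>j\<in>I. E j (\<sigma> j) (\<tau> j)) \<and> \<phi> \<sigma> \<noteq> \<phi> \<tau>}
    \<le> m * (\<Sum>j\<in>I. card (W j))"
proof -
  define P where "P = I \<rightarrow>\<^sub>E \<Omega>"
  define R where "R = {(\<sigma>, \<tau>). \<sigma> \<in> P \<and> \<tau> \<in> P \<and> (\<forall>j\<in>I. E j (\<sigma> j) (\<tau> j))}"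
  have finP: "finite P" by (simp add: P_def fin finite_PiE)
  have finR: "finite R" by (rule finite_subset[of _ "P \<times> P"]) (auto simp: R_def finP)
  have step: "card {(\<sigma>, \<tau>) \<in> R. \<phi> \<sigma> \<noteq> \<phi> (\<sigma>(j := \<tau> j))} \<le> m * card (W j)" if "j \<in> I" for j
  proof -
    have "{(\<sigma>, \<tau>) \<in> R. \<phi> \<sigma> \<noteq> \<phi> (\<sigma>(j := \<tau> j))}
        \<subseteq> Sigma (W j) (\<lambda>\<sigma>. {\<tau> \<in> P. \<forall>j\<in>I. E j (\<sigma> j) (\<tau> j)})"
      using W[OF that] by (auto simp: R_def P_def)
    moreover have finW: "finite (W j)" using W_sub[OF that] finP finite_subset unfolding P_def by blast
    ultimately have "card {(\<sigma>, \<tau>) \<in> R. \<phi> \<sigma> \<noteq> \<phi> (\<sigma>(j := \<tau> j))}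
        \<le> card (Sigma (W j) (\<lambda>\<sigma>. {\<tau> \<in> P. \<forall>j\<in>I. E j (\<sigma> j) (\<tau> j)}))"
      using finP by (intro card_mono) auto
    also have "\<dots> = (\<Sum>\<sigma>\<in>W j. card {\<tau> \<in> P. \<forall>j\<in>I. E j (\<sigma> j) (\<tau> j)})"
      using finW finP by (intro card_SigmaI) auto
    also have "\<dots> = (\<Sum>\<sigma>\<in>W j. m)"
      using W_sub[OF that] fib unfolding P_def by (intro sum.cong) auto
    finally show ?thesis by (simp add: mult.commute)
  qed
  \<comment> \<open>\<open>override_on \<sigma> \<tau> J\<close> is the position of the walk once
    the coordinates in \<open>J\<close> have been replaced.\<close>
  have "card {(\<sigma>, \<tau>) \<in> R. \<phi> \<sigma> \<noteq> \<phi> (override_on \<sigma> \<tau> J)} \<le> m * (\<Sum>j\<in>J. card (W j))"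
    if "J \<subseteq> I" for J
    using finite_subset[OF that fin(1)] that
  proof (induction J rule: finite_induct)
    case empty
    then show ?case by (simp add: case_prod_unfold)
  next
    case (insert j J)
    define h where "h = (\<lambda>(\<sigma> :: 'i \<Rightarrow> 'a, \<tau>). (override_on \<sigma> \<tau> J, override_on \<tau> \<sigma> J))"
    let ?D = "{(\<sigma>, \<tau>) \<in> R. \<phi> \<sigma> \<noteq> \<phi> (\<sigma>(j := \<tau> j))}"
    let ?A = "{(\<sigma>, \<tau>) \<in> R. \<phi> \<sigma> \<noteq> \<phi> (override_on \<sigma> \<tau> J)}"
    let ?B = "{(\<sigma>, \<tau>) \<in> R. \<phi> (override_on \<sigma> \<tau> J) \<noteq> \<phi> (override_on \<sigma> \<tau> (insert j J))}"
    have hh: "h (h p) = p" for p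
      by (cases p) (auto simp: h_def override_on_def fun_eq_iff)
    have ov: "override_on \<sigma> \<tau> J \<in> P" if "\<sigma> \<in> P" "\<tau> \<in> P" for \<sigma> \<tau>
      using that insert.prems by (auto simp: P_def override_on_def PiE_iff extensional_def)
    \<comment> \<open>On \<open>J\<close> the two profiles trade places, so staying in
      \<open>R\<close> uses the symmetry of \<open>E\<close>.\<close>
    have hR: "h p \<in> R" if "p \<in> R" for p
      using that sym ov by (cases p) (auto simp: h_def R_def override_on_def)
    have "h ` ?B \<subseteq> ?D"
    proof
      fix q assume "q \<in> h ` ?B"
      then obtain \<sigma> \<tau> where st: "(\<sigma>, \<tau>) \<in> R" "q = h (\<sigma>, \<tau>)"
        and ne: "\<phi> (override_on \<sigma> \<tau> J) \<noteq> \<phi> (override_on \<sigma> \<tau> (insert j J))" by auto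
      \<comment> \<open>Since \<open>j\<close> is not in \<open>J\<close>, the second swapped
        profile still carries \<open>\<tau> j\<close>, so the step at \<open>j\<close> is a single
        update of the first swapped profile.\<close>
      have "override_on \<sigma> \<tau> (insert j J) = (override_on \<sigma> \<tau> J)(j := override_on \<tau> \<sigma> J j)"
        using insert.hyps by (auto simp: override_on_def fun_eq_iff)
      then show "q \<in> ?D" using hR[OF st(1)] ne st(2) by (auto simp: h_def)
    qed
    moreover have "inj_on h ?B" using hh by (rule inj_on_inverseI)
    moreover have "finite ?D" by (rule finite_subset[OF _ finR]) auto
    ultimately have B: "card ?B \<le> card ?D" by (intro card_inj_on_le[of h])
    have "card {(\<sigma>, \<tau>) \<in> R. \<phi> \<sigma> \<noteq> \<phi> (override_on \<sigma> \<tau> (insert j J))} \<le> card (?A \<union> ?B)"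
      by (rule card_mono) (auto intro: finite_subset[OF _ finR])
    also have "\<dots> \<le> card ?A + card ?B" by (rule card_Un_le)
    also have "\<dots> \<le> m * (\<Sum>j\<in>J. card (W j)) + m * card (W j)"
      using insert B step[of j] by fastforce
    finally show ?case using insert.hyps by (simp add: algebra_simps)
  qed
  from this[of I] have "card {(\<sigma>, \<tau>) \<in> R. \<phi> \<sigma> \<noteq> \<phi> (override_on \<sigma> \<tau> I)} \<le> m * (\<Sum>j\<in>I. card (W j))" by simp
  moreover have "{(\<sigma>, \<tau>) \<in> R. \<phi> \<sigma> \<noteq> \<phi> (override_on \<sigma> \<tau> I)} = {(\<sigma>, \<tau>) \<in> R. \<phi> \<sigma> \<noteq> \<phi> \<tau>}"
  proof -
    \<comment> \<open>Both profiles are \<open>undefined\<close> off \<open>I\<close>, so the walk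
      ends exactly at \<open>\<tau>\<close>.\<close>
    have "override_on \<sigma> \<tau> I = \<tau>" if "(\<sigma>, \<tau>) \<in> R" for \<sigma> \<tau>
      using that by (auto simp: R_def P_def override_on_def fun_eq_iff PiE_iff extensional_def)
    then show ?thesis by force
  qed
  moreover have "{(\<sigma>, \<tau>) \<in> R. \<phi> \<sigma> \<noteq> \<phi> \<tau>} = {(\<sigma>, \<tau>). \<sigma> \<in> I \<rightarrow>\<^sub>E \<Omega> \<and> \<tau> \<in> I \<rightarrow>\<^sub>E \<Omega> \<and> (\<forall>j\<in>I. E j (\<sigma> j) (\<tau> j)) \<and> \<phi> \<sigma> \<noteq> \<phi> \<tau>}"
    by (auto simp: R_def P_def)
  ultimately show ?thesis by simp
qed

text \<open>Fubini for one extra coordinate; it drives the induction in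
  \<open>correlated_intersection\<close>.\<close>

lemma card_PiE_insert_slices:
  assumes "finite I" "finite \<Omega>" "i \<notin> I" and A: "A \<subseteq> insert i I \<rightarrow>\<^sub>E \<Omega>"
  shows "card A = (\<Sum>r\<in>\<Omega>. card {\<sigma> \<in> I \<rightarrow>\<^sub>E \<Omega>. \<sigma>(i := r) \<in> A})"
proof -
  let ?S = "Sigma \<Omega> (\<lambda>r. {\<sigma> \<in> I \<rightarrow>\<^sub>E \<Omega>. \<sigma>(i := r) \<in> A})"
  have "inj_on (\<lambda>(r, \<sigma>). \<sigma>(i := r)) ?S"
  proof (rule inj_onI, clarsimp)
    fix r \<sigma> r' \<sigma>'
    assume *: "\<sigma> \<in> I \<rightarrow>\<^sub>E \<Omega>" "\<sigma>' \<in> I \<rightarrow>\<^sub>E \<Omega>" "\<sigma>(i := r) = \<sigma>'(i := r')"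
    \<comment> \<open>A slice element has the default value at \<open>i\<close>, so the updated
      function determines both the value and the slice element.\<close>
    have "\<sigma> i = undefined" "\<sigma>' i = undefined" using * \<open>i \<notin> I\<close> by (auto simp: PiE_iff extensional_def)
    then show "r = r' \<and> \<sigma> = \<sigma>'" using *(3) by (metis fun_upd_same fun_upd_triv fun_upd_upd)
  qed
  moreover have "(\<lambda>(r, \<sigma>). \<sigma>(i := r)) ` ?S = A"
  proof
    show "A \<subseteq> (\<lambda>(r, \<sigma>). \<sigma>(i := r)) ` ?S"
    proof
      fix \<sigma> assume s: "\<sigma> \<in> A"
      then have "\<sigma> \<in> insert i I \<rightarrow>\<^sub>E \<Omega>" using A by auto
      then have "\<sigma> i \<in> \<Omega>" "\<sigma>(i := undefined) \<in> I \<rightarrow>\<^sub>E \<Omega>"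
        using \<open>i \<notin> I\<close> by (auto simp: PiE_iff extensional_def)
      then show "\<sigma> \<in> (\<lambda>(r, \<sigma>). \<sigma>(i := r)) ` ?S"
        using s by (intro image_eqI[of _ _ "(\<sigma> i, \<sigma>(i := undefined))"]) auto
    qed
  qed auto
  ultimately have "card A = card ?S" using card_image by fastforce
  also have "\<dots> = (\<Sum>r\<in>\<Omega>. card {\<sigma> \<in> I \<rightarrow>\<^sub>E \<Omega>. \<sigma>(i := r) \<in> A})"
    using assms by (intro card_SigmaI) (auto simp: finite_PiE)
  finally show ?thesis .
qed

section \<open>Reverse hypercontractivity for correlated bits\<close>

text \<open>The one-coordinate inequality behind \<open>correlated_intersection\<close>:
  \<open>q\<close> is the size of the cells where two balanced bits agree, \<open>h - q\<close> that
  of the cells where they differ. In terms of sums and differences of the weights, the gap between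
  the two sides is a nonnegative term plus a quadratic form in \<open>a * t\<close> and
  \<open>b * s\<close>, which is nonnegative because its cross term is small.\<close>

lemma two_point_reverse_hypercontractivity:
  fixes a0 a1 b0 b1 h q :: real
  assumes "h \<ge> 0" "h \<le> 4 * q" "4 * q \<le> 3 * h" 
    and "a0 \<ge> 0" "a1 \<ge> 0" "b0 \<ge> 0" "b1 \<ge> 0"
  shows "h * ((a0 + a1) * (b0 + b1))\<^sup>2 \<le>
    8 * (q * (a1\<^sup>2 * b1\<^sup>2 + a0\<^sup>2 * b0\<^sup>2) + (h - q) * (a1\<^sup>2 * b0\<^sup>2 + a0\<^sup>2 * b1\<^sup>2))"
proof -
  define a s b t where "a = a1 + a0" and "s = a1 - a0" and "b = b1 + b0" and "t = b1 - b0"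
  have ab: "a1 = (a + s) / 2" "a0 = (a - s) / 2" "b1 = (b + t) / 2" "b0 = (b - t) / 2"
    by (auto simp: a_def s_def b_def t_def)
  have "8 * (q * (a1\<^sup>2 * b1\<^sup>2 + a0\<^sup>2 * b0\<^sup>2) + (h - q) * (a1\<^sup>2 * b0\<^sup>2 + a0\<^sup>2 * b1\<^sup>2))
      - h * ((a0 + a1) * (b0 + b1))\<^sup>2
      = h * (s\<^sup>2 * t\<^sup>2) + h * (a\<^sup>2 * t\<^sup>2 + b\<^sup>2 * s\<^sup>2) + 4 * (2 * q - h) * (a * t) * (b * s)"
    unfolding ab by (simp add: field_simps power2_eq_square)
  \<comment> \<open>The correlation bound enters here: with \<open>4 * q\<close> between
    \<open>h\<close> and \<open>3 * h\<close>, the coefficient \<open>4 * (2 * q - h)\<close> is at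
    most \<open>2 * h\<close> in absolute value, and the AM-GM inequality does the rest.\<close>
  moreover have "\<bar>4 * (2 * q - h) * (a * t) * (b * s)\<bar> \<le> h * (a\<^sup>2 * t\<^sup>2 + b\<^sup>2 * s\<^sup>2)"
  proof -
    have "\<bar>4 * (2 * q - h) * (a * t) * (b * s)\<bar> = \<bar>4 * (2 * q - h)\<bar> * (\<bar>a * t\<bar> * \<bar>b * s\<bar>)"
      by (simp add: abs_mult)
    also have "\<dots> \<le> (2 * h) * (\<bar>a * t\<bar> * \<bar>b * s\<bar>)"
      using assms by (intro mult_right_mono) auto
    also have "\<dots> = h * (2 * \<bar>a * t\<bar> * \<bar>b * s\<bar>)" by simp
    also have "\<dots> \<le> h * (\<bar>a * t\<bar>\<^sup>2 + \<bar>b * s\<bar>\<^sup>2)"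
      using assms sum_squares_bound[of "\<bar>a * t\<bar>" "\<bar>b * s\<bar>"] by (intro mult_left_mono) auto
    finally show ?thesis by (simp add: power_mult_distrib)
  qed
  moreover have "h * (s\<^sup>2 * t\<^sup>2) \<ge> 0" using assms by simp
  ultimately show ?thesis by linarith
qed

lemma sum_over_two_bits:
  fixes F :: "bool \<Rightarrow> bool \<Rightarrow> real"
  assumes "finite \<Omega>"
  shows "(\<Sum>r\<in>\<Omega>. F (x r) (y r)) = 
     card {r \<in> \<Omega>. x r \<and> y r} * F True True + card {r \<in> \<Omega>. x r \<and> \<not> y r} * F True False
     + card {r \<in> \<Omega>. \<not> x r \<and> y r} * F False True + card {r \<in> \<Omega>. \<not> x r \<and> \<not> y r} * F False False"
proof -
  have "F (x r) (y r) = (if x r \<and> y r then F True True else 0) + (if x r \<and> \<not> y r then F True False else 0)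
     + (if \<not> x r \<and> y r then F False True else 0) + (if \<not> x r \<and> \<not> y r then F False False else 0)" for r
    by (cases "x r"; cases "y r") auto
  then show ?thesis using assms by (simp add: sum.distrib flip: sum.inter_filter)
qed

text \<open>
  The bounds on the joint count say that the balanced bits \<open>x\<close> and \<open>y\<close> have correlation at most
  \<open>1/2\<close> in absolute value.
\<close>
lemma correlated_intersection:
  fixes x y :: "'a \<Rightarrow> bool" and A B :: "('i \<Rightarrow> 'a) set"
  assumes fin: "finite I" "finite \<Omega>"
    and bal: "2 * card {r \<in> \<Omega>. x r} = card \<Omega>" "2 * card {r \<in> \<Omega>. y r} = card \<Omega>"
    and corr: "card \<Omega> \<le> 8 * card {r \<in> \<Omega>. x r \<and> y r}" "8 * card {r \<in> \<Omega>. x r \<and> y r} \<le> 3 * card \<Omega>"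
    and A: "A \<subseteq> I \<rightarrow>\<^sub>E \<Omega>" "\<And>\<sigma> \<tau>. \<lbrakk>\<sigma> \<in> A; \<tau> \<in> I \<rightarrow>\<^sub>E \<Omega>; \<forall>i\<in>I. x (\<sigma> i) = x (\<tau> i)\<rbrakk> \<Longrightarrow> \<tau> \<in> A"
    and B: "B \<subseteq> I \<rightarrow>\<^sub>E \<Omega>" "\<And>\<sigma> \<tau>. \<lbrakk>\<sigma> \<in> B; \<tau> \<in> I \<rightarrow>\<^sub>E \<Omega>; \<forall>i\<in>I. y (\<sigma> i) = y (\<tau> i)\<rbrakk> \<Longrightarrow> \<tau> \<in> B"
  shows "(real (card A))\<^sup>2 * (real (card B))\<^sup>2 \<le> real (card (A \<inter> B)) * real (card \<Omega>) ^ (3 * card I)"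
  using fin(1) A B
proof (induction I arbitrary: A B rule: finite_induct)
  \<comment> \<open>The product over no coordinates is a single point, so all cardinalities are 0 or
    1.\<close>
  case empty
  then have "A = {} \<or> A = {\<lambda>_. undefined}" "B = {} \<or> B = {\<lambda>_. undefined}"
    by (auto simp: subset_singleton_iff)
  then show ?case by auto
next
  case (insert i I)
  define P where "P = I \<rightarrow>\<^sub>E \<Omega>"
  \<comment> \<open>For an \<open>A\<close> that depends on bits only, \<open>S x A u\<close> is the
    slice of \<open>A\<close> at every value of the new coordinate with bit \<open>u\<close>,
    although its definition asks for just one such value.\<close>
  define S where "S = (\<lambda>x (A :: ('i \<Rightarrow> 'a) set) u. {\<sigma> \<in> P. \<exists>r\<in>\<Omega>. x r = (u :: bool) \<and> \<sigma>(i := r) \<in> A})"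
  have upd: "\<sigma>(i := r) \<in> insert i I \<rightarrow>\<^sub>E \<Omega>" if "\<sigma> \<in> P" "r \<in> \<Omega>" for \<sigma> r
    using that by (auto simp: P_def PiE_iff extensional_def)
  have slice: "{\<sigma> \<in> P. \<sigma>(i := r) \<in> A} = S x A (x r)"
    if "r \<in> \<Omega>" and inv: "\<And>\<sigma> \<tau>. \<lbrakk>\<sigma> \<in> A; \<tau> \<in> insert i I \<rightarrow>\<^sub>E \<Omega>; \<forall>i\<in>insert i I. x (\<sigma> i) = x (\<tau> i)\<rbrakk> \<Longrightarrow> \<tau> \<in> A"
    for x A r
  proof -
    have "\<sigma>(i := r) \<in> A" if "\<sigma> \<in> P" "r' \<in> \<Omega>" "x r' = x r" "\<sigma>(i := r') \<in> A" for \<sigma> r'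
      using inv[OF that(4) upd[OF that(1) \<open>r \<in> \<Omega>\<close>]] that(3) by auto
    then show ?thesis using \<open>r \<in> \<Omega>\<close> by (auto simp: S_def)
  qed
  have S_inv: "\<tau> \<in> S x A u"
    if "\<sigma> \<in> S x A u" "\<tau> \<in> P" "\<forall>i\<in>I. x (\<sigma> i) = x (\<tau> i)"
      and inv: "\<And>\<sigma> \<tau>. \<lbrakk>\<sigma> \<in> A; \<tau> \<in> insert i I \<rightarrow>\<^sub>E \<Omega>; \<forall>i\<in>insert i I. x (\<sigma> i) = x (\<tau> i)\<rbrakk> \<Longrightarrow> \<tau> \<in> A"
    for x A u \<sigma> \<tau>
  proof -
    from that(1) obtain r where r: "r \<in> \<Omega>" "x r = u" "\<sigma>(i := r) \<in> A" by (auto simp: S_def)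
    have "\<tau>(i := r) \<in> A" using inv[OF r(3) upd[OF that(2) r(1)]] that(3) insert.hyps by auto
    then show ?thesis using r that(2) by (auto simp: S_def)
  qed
  note invA = insert.prems(2) and invB = insert.prems(4)
  have sliceA: "{\<sigma> \<in> P. \<sigma>(i := r) \<in> A} = S x A (x r)" if "r \<in> \<Omega>" for r
    by (rule slice[OF that]) (rule invA)
  have sliceB: "{\<sigma> \<in> P. \<sigma>(i := r) \<in> B} = S y B (y r)" if "r \<in> \<Omega>" for r
    by (rule slice[OF that]) (rule invB)
  define \<alpha> where "\<alpha> u = real (card (S x A u))" for u
  define \<beta> where "\<beta> u = real (card (S y B u))" for u
  define \<gamma> where "\<gamma> u v = real (card (S x A u \<inter> S y B v))" for u v
  define q where "q = real (card {r \<in> \<Omega>. x r \<and> y r})"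
  define N where "N = real (card \<Omega>)"
  define C where "C = N ^ (3 * card I)"
  have "N \<ge> 0" "C \<ge> 0" by (auto simp: N_def C_def)
  have IH: "(\<alpha> u)\<^sup>2 * (\<beta> v)\<^sup>2 \<le> \<gamma> u v * C" for u v
    unfolding \<alpha>_def \<beta>_def \<gamma>_def C_def N_def
  proof (rule insert.IH)
    show "\<tau> \<in> S x A u" if "\<sigma> \<in> S x A u" "\<tau> \<in> I \<rightarrow>\<^sub>E \<Omega>" "\<forall>i\<in>I. x (\<sigma> i) = x (\<tau> i)" for \<sigma> \<tau>
      using that unfolding P_def[symmetric] by (rule S_inv) (rule invA)
    show "\<tau> \<in> S y B v" if "\<sigma> \<in> S y B v" "\<tau> \<in> I \<rightarrow>\<^sub>E \<Omega>" "\<forall>i\<in>I. y (\<sigma> i) = y (\<tau> i)" for \<sigma> \<tau>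
      using that unfolding P_def[symmetric] by (rule S_inv) (rule invB)
  qed (auto simp: S_def P_def)
  \<comment> \<open>Both marginals being \<open>N / 2\<close>, the size \<open>q\<close> of one cell
    determines the other three.\<close>
  have cells: "real (card {r \<in> \<Omega>. x r \<and> \<not> y r}) = N / 2 - q" "real (card {r \<in> \<Omega>. \<not> x r \<and> y r}) = N / 2 - q"
    "real (card {r \<in> \<Omega>. \<not> x r \<and> \<not> y r}) = q"
  proof -
    have split: "card {r \<in> \<Omega>. p r} = card {r \<in> \<Omega>. p r \<and> p' r} + card {r \<in> \<Omega>. p r \<and> \<not> p' r}" for p p'
      using fin(2) by (subst card_Un_disjoint[symmetric]) (auto intro: arg_cong[where f=card])
    have "card \<Omega> = card {r \<in> \<Omega>. x r} + card {r \<in> \<Omega>. \<not> x r}"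
      using split[of "\<lambda>_. True" x] by simp
    moreover have "card {r \<in> \<Omega>. y r} = card {r \<in> \<Omega>. x r \<and> y r} + card {r \<in> \<Omega>. \<not> x r \<and> y r}"
      using split[of y x] by (simp add: conj_commute)
    moreover note split[of x y] split[of "\<lambda>r. \<not> x r" y]
    ultimately show "real (card {r \<in> \<Omega>. x r \<and> \<not> y r}) = N / 2 - q"
      "real (card {r \<in> \<Omega>. \<not> x r \<and> y r}) = N / 2 - q" "real (card {r \<in> \<Omega>. \<not> x r \<and> \<not> y r}) = q"
      using bal unfolding N_def q_def by linarith+
  qed
  have cA: "real (card A) = N / 2 * (\<alpha> False + \<alpha> True)"
  proof -
    have "real (card A) = (\<Sum>r\<in>\<Omega>. \<alpha> (x r))"
      using card_PiE_insert_slices[OF insert.hyps(1) fin(2) insert.hyps(2) insert.prems(1)] sliceA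
      by (simp add: P_def \<alpha>_def)
    then show ?thesis using sum_over_two_bits[OF fin(2), of "\<lambda>u v. \<alpha> u" x y] cells
      by (simp add: q_def[symmetric] algebra_simps)
  qed
  have cB: "real (card B) = N / 2 * (\<beta> False + \<beta> True)"
  proof -
    have "real (card B) = (\<Sum>r\<in>\<Omega>. \<beta> (y r))"
      using card_PiE_insert_slices[OF insert.hyps(1) fin(2) insert.hyps(2) insert.prems(3)] sliceB
      by (simp add: P_def \<beta>_def)
    then show ?thesis using sum_over_two_bits[OF fin(2), of "\<lambda>u v. \<beta> v" x y] cells
      by (simp add: q_def[symmetric] algebra_simps)
  qed
  have cAB: "real (card (A \<inter> B)) = q * (\<gamma> True True + \<gamma> False False) + (N / 2 - q) * (\<gamma> True False + \<gamma> False True)"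
  proof -
    have "{\<sigma> \<in> P. \<sigma>(i := r) \<in> A \<inter> B} = S x A (x r) \<inter> S y B (y r)" if "r \<in> \<Omega>" for r
      using sliceA[OF that] sliceB[OF that] by auto
    then have "real (card (A \<inter> B)) = (\<Sum>r\<in>\<Omega>. \<gamma> (x r) (y r))"
      using card_PiE_insert_slices[OF insert.hyps(1) fin(2) insert.hyps(2), of "A \<inter> B"] insert.prems(1)
      by (simp add: P_def \<gamma>_def le_infI1)
    then show ?thesis using sum_over_two_bits[OF fin(2), of \<gamma> x y] cells
      by (simp add: q_def[symmetric] algebra_simps)
  qed
  have q: "N / 2 \<le> 4 * q" "4 * q \<le> 3 * (N / 2)" using corr unfolding N_def q_def by linarith+
  \<comment> \<open>The left side scales as \<open>N ^ 4\<close> and the intersection as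
    \<open>N\<close>; the surplus \<open>N ^ 3\<close> is the normalisation of one more
    coordinate.\<close>
  have "(real (card A))\<^sup>2 * (real (card B))\<^sup>2 = N ^ 3 / 8 * (N / 2 * ((\<alpha> False + \<alpha> True) * (\<beta> False + \<beta> True))\<^sup>2)"
    unfolding cA cB by (simp add: power_mult_distrib power2_eq_square power3_eq_cube)
  also have "\<dots> \<le> N ^ 3 / 8 * (8 * (q * ((\<alpha> True)\<^sup>2 * (\<beta> True)\<^sup>2 + (\<alpha> False)\<^sup>2 * (\<beta> False)\<^sup>2)
      + (N / 2 - q) * ((\<alpha> True)\<^sup>2 * (\<beta> False)\<^sup>2 + (\<alpha> False)\<^sup>2 * (\<beta> True)\<^sup>2)))"
    using q \<open>N \<ge> 0\<close> by (intro mult_left_mono two_point_reverse_hypercontractivity) (auto simp: \<alpha>_def \<beta>_def)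
  also have "\<dots> \<le> N ^ 3 / 8 * (8 * (q * (\<gamma> True True * C + \<gamma> False False * C)
      + (N / 2 - q) * (\<gamma> True False * C + \<gamma> False True * C)))"
    using q \<open>N \<ge> 0\<close> by (intro mult_left_mono add_mono IH) auto
  also have "\<dots> = real (card (A \<inter> B)) * (N ^ 3 * C)"
    unfolding cAB by (simp add: algebra_simps)
  also have "N ^ 3 * C = N ^ (3 * card (insert i I))"
    using insert.hyps by (simp add: C_def power_add)
  finally show ?case unfolding N_def .
qed

section \<open>Rankings and the two-voter Gibbard--Satterthwaite theorem\<close>

lemma rankingsD:
  assumes "r \<in> rankings k"
  shows "r \<subseteq> {1..k} \<times> {1..k}" "\<And>a. a \<in> {1..k} \<Longrightarrow> (a, a) \<in> r"
    "\<And>a b c. (a, b) \<in> r \<Longrightarrow> (b, c) \<in> r \<Longrightarrow> (a, c) \<in> r"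
    "\<And>a b. (a, b) \<in> r \<Longrightarrow> (b, a) \<in> r \<Longrightarrow> a = b"
    "\<And>a b. a \<in> {1..k} \<Longrightarrow> b \<in> {1..k} \<Longrightarrow> (a, b) \<in> r \<or> (b, a) \<in> r"
proof -
  have *: "refl_on {1..k} r" "r \<subseteq> {1..k} \<times> {1..k}" "trans r" "antisym r" "total_on {1..k} r"
    using assms by (auto simp: rankings_def order_on_defs)
  show "r \<subseteq> {1..k} \<times> {1..k}" by fact
  show refl: "(a, a) \<in> r" if "a \<in> {1..k}" for a using *(1) that by (rule refl_onD)
  show "(a, c) \<in> r" if "(a, b) \<in> r" "(b, c) \<in> r" for a b c using *(3) that by (rule transD)
  show "a = b" if "(a, b) \<in> r" "(b, a) \<in> r" for a b using *(4) that by (rule antisymD)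
  show "(a, b) \<in> r \<or> (b, a) \<in> r" if "a \<in> {1..k}" "b \<in> {1..k}" for a b
    using *(5) that refl by (cases "a = b") (auto simp: total_on_def)
qed

lemma ranks_above_iff:
  assumes "r \<in> rankings k" "a \<in> {1..k}" "b \<in> {1..k}"
  shows "ranks_above r a b \<longleftrightarrow> (a, b) \<notin> r"
  using rankingsD[OF assms(1)] assms(2,3) unfolding ranks_above_def by metis

lemma ranking_of_scores:
  fixes h :: "nat \<Rightarrow> nat"
  assumes "inj_on h {1..k}"
  shows "{(a, b). a \<in> {1..k} \<and> b \<in> {1..k} \<and> h a \<le> h b} \<in> rankings k"
  using inj_onD[OF assms]
  by (auto simp: rankings_def order_on_defs refl_on_def trans_def antisym_def total_on_def)

lemma ex_ranking_with_first_two: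
  assumes "x \<in> {1..k}" "y \<in> {1..k}" "x \<noteq> y"
  obtains r where "r \<in> rankings k" "\<And>w. w \<in> {1..k} \<Longrightarrow> (w, x) \<in> r"
    "\<And>w. w \<in> {1..k} \<Longrightarrow> w \<noteq> x \<Longrightarrow> (w, y) \<in> r"
proof
  \<comment> \<open>Scores above \<open>k\<close> put \<open>x\<close> first and \<open>y\<close>
    second; the others keep their own number as score.\<close>
  define h where "h z = (if z = x then k + 2 else if z = y then k + 1 else z)" for z
  have "inj_on h {1..k}" using assms by (auto simp: inj_on_def h_def)
  then show "{(a, b). a \<in> {1..k} \<and> b \<in> {1..k} \<and> h a \<le> h b} \<in> rankings k"
    by (rule ranking_of_scores)
qed (use assms in \<open>auto simp: \<open>x \<noteq> y\<close>\<close>)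

lemma ranking_has_top:
  assumes "r \<in> rankings k" "finite S" "S \<noteq> {}" "S \<subseteq> {1..k}"
  obtains t where "t \<in> S" "\<And>y. y \<in> S \<Longrightarrow> (y, t) \<in> r"
proof -
  have "\<exists>t\<in>S. \<forall>y\<in>S. (y, t) \<in> r"
    using assms(2-4)
  proof (induction S rule: finite_ne_induct)
    case (singleton x)
    then show ?case using rankingsD(2)[OF assms(1)] by auto
  next
    case (insert x F)
    then obtain t where t: "t \<in> F" "\<forall>y\<in>F. (y, t) \<in> r" by auto
    have "x \<in> {1..k}" "t \<in> {1..k}" using insert.prems t(1) by auto
    then have "(x, t) \<in> r \<or> (t, x) \<in> r" by (rule rankingsD(5)[OF assms(1)])
    then show ?case
    proof
      assume "(x, t) \<in> r"
      then show ?thesis using t by blast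
    next
      assume "(t, x) \<in> r"
      then have "\<forall>y\<in>insert x F. (y, x) \<in> r"
        using t rankingsD(2,3)[OF assms(1)] insert.prems by blast
      then show ?thesis by blast
    qed
  qed
  then show ?thesis using that by blast
qed

text \<open>
  Barbera and Peleg's option sets: given the second voter's ranking \<open>s\<close>, the first voter obtains
  her best element of the set \<open>Opt s\<close> of outcomes she can reach, and \<open>Opt s\<close> turns out to be
  either the second voter's favourite alone or the whole range.
\<close>
lemma two_voter_Gibbard_Satterthwaite:
  fixes g :: "nat rel \<Rightarrow> nat rel \<Rightarrow> nat"
  assumes g: "\<And>r s. r \<in> rankings k \<Longrightarrow> s \<in> rankings k \<Longrightarrow> g r s \<in> {1..k}"
    and sp1: "\<And>r r' s. \<lbrakk>r \<in> rankings k; r' \<in> rankings k; s \<in> rankings k\<rbrakk> \<Longrightarrow> \<not> ranks_above r (g r' s) (g r s)"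
    and sp2: "\<And>r s s'. \<lbrakk>r \<in> rankings k; s \<in> rankings k; s' \<in> rankings k\<rbrakk> \<Longrightarrow> \<not> ranks_above s (g r s') (g r s)"
  shows "(\<forall>r\<in>rankings k. \<forall>s\<in>rankings k. \<forall>s'\<in>rankings k. g r s = g r s') \<or>
    (\<forall>r\<in>rankings k. \<forall>r'\<in>rankings k. \<forall>s\<in>rankings k. g r s = g r' s) \<or>
    (\<exists>a b. \<forall>r\<in>rankings k. \<forall>s\<in>rankings k. g r s \<in> {a, b})"
proof (cases "\<exists>a b. \<forall>r\<in>rankings k. \<forall>s\<in>rankings k. g r s \<in> {a, b}")
  case False
  let ?L = "rankings k"
  define V where "V = {g r s | r s. r \<in> ?L \<and> s \<in> ?L}"
  define Opt where "Opt s = (\<lambda>r. g r s) ` ?L" for s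
  define top where "top r t \<longleftrightarrow> t \<in> V \<and> (\<forall>y\<in>V. (y, t) \<in> r)" for r t
  have Vk: "V \<subseteq> {1..k}" using g by (auto simp: V_def)
  have OptV: "Opt s \<subseteq> V" if "s \<in> ?L" for s using that by (auto simp: Opt_def V_def)
  have gV: "g r s \<in> V" if "r \<in> ?L" "s \<in> ?L" for r s using that by (auto simp: V_def)
  have best1: "(g r' s, g r s) \<in> r" if "r \<in> ?L" "r' \<in> ?L" "s \<in> ?L" for r r' s
    using sp1[OF that] ranks_above_iff g that rankingsD(5) by metis
  have best2: "(g r s', g r s) \<in> s" if "r \<in> ?L" "s \<in> ?L" "s' \<in> ?L" for r s s'
    using sp2[OF that] ranks_above_iff g that rankingsD(5) by metis
  have ex_top: "\<exists>t. top r t" if r: "r \<in> ?L" for r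
  proof -
    have "V \<noteq> {}" using gV[OF r r] by auto
    moreover have "finite V" using Vk by (rule finite_subset) simp
    ultimately obtain t where "t \<in> V" "\<And>y. y \<in> V \<Longrightarrow> (y, t) \<in> r"
      using ranking_has_top[OF r _ _ Vk] by blast
    then show ?thesis by (auto simp: top_def)
  qed
  \<comment> \<open>Start from any pair of rankings with outcome \<open>t\<close> and switch the
    voters to \<open>r\<close> and \<open>s\<close> in turn. A switch to the true ranking cannot
    hurt that voter, for whom \<open>t\<close> is already the best value.\<close>
  have unanimous: "g r s = t" if "r \<in> ?L" "s \<in> ?L" "top r t" "top s t" for r s t
  proof -
    from that(3) obtain r0 s0 where rs0: "r0 \<in> ?L" "s0 \<in> ?L" "t = g r0 s0" by (auto simp: top_def V_def)
    have "g r s0 = t"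
      using best1[OF that(1) rs0(1,2)] that(1,3) gV[OF that(1) rs0(2)] rankingsD(4)[OF that(1)] rs0(3)
      by (auto simp: top_def)
    then show ?thesis
      using best2[OF that(1,2) rs0(2)] that(4) gV[OF that(1,2)] rankingsD(4)[OF that(2)]
      by (auto simp: top_def)
  qed
  have best_opt: "(x, g r s) \<in> r" if "r \<in> ?L" "s \<in> ?L" "x \<in> Opt s" for r s x
    using that best1 by (auto simp: Opt_def)
  have top_opt: "t \<in> Opt s" if "s \<in> ?L" "top s t" for s t
    using unanimous[OF that(1,1,2,2)] that(1) by (auto simp: Opt_def)
  \<comment> \<open>So the option set depends only on the favourite \<open>t\<close>. Let the first
    voter rank \<open>x\<close> first and \<open>t\<close> second: she gets \<open>x\<close> against
    \<open>s\<close>, and \<open>x\<close> or \<open>t\<close> against \<open>s'\<close>. Outcome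
    \<open>t\<close> would tempt a second voter with ranking \<open>s\<close> to report
    \<open>s'\<close>.\<close>
  have Opt_mono: "Opt s \<subseteq> Opt s'" if s: "s \<in> ?L" "s' \<in> ?L" "top s t" "top s' t" for s s' t
  proof
    fix x assume x: "x \<in> Opt s"
    show "x \<in> Opt s'"
    proof (cases "x = t")
      case True
      then show ?thesis using top_opt s by blast
    next
      case False
      have xt: "x \<in> {1..k}" "t \<in> {1..k}" using x OptV[OF s(1)] s(3) Vk by (auto simp: top_def)
      obtain r where r: "r \<in> ?L" "\<And>w. w \<in> {1..k} \<Longrightarrow> (w, x) \<in> r"
        "\<And>w. w \<in> {1..k} \<Longrightarrow> w \<noteq> x \<Longrightarrow> (w, t) \<in> r"
        using ex_ranking_with_first_two[OF xt False] by blast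
      have 1: "g r s = x" using best_opt[OF r(1) s(1) x] r(2) g[OF r(1) s(1)] rankingsD(4)[OF r(1)] by blast
      have "g r s' = x \<or> g r s' = t"
        using best_opt[OF r(1) s(2) top_opt[OF s(2,4)]] r(3) g[OF r(1) s(2)] rankingsD(4)[OF r(1)] by blast
      moreover have "g r s' \<noteq> t"
      proof
        assume "g r s' = t"
        then have "(t, x) \<in> s" using best2[OF r(1) s(1,2)] 1 by simp
        moreover have "(x, t) \<in> s" using s(3) x OptV[OF s(1)] by (auto simp: top_def)
        ultimately show False using rankingsD(4)[OF s(1)] False by blast
      qed
      ultimately show ?thesis using r(1) by (auto simp: Opt_def)
    qed
  qed
  \<comment> \<open>Suppose \<open>x \<noteq> t\<close> is an option and \<open>y\<close> is not. If
    the first voter ranks \<open>y\<close> then \<open>x\<close> and the second ranks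
    \<open>t\<close> then \<open>y\<close>, the outcome is \<open>x\<close>; the second voter gains
    by copying the first, since unanimity then gives \<open>y\<close>.\<close>
  have Opt_dichotomy: "Opt s = {t} \<or> Opt s = V" if s: "s \<in> ?L" "top s t" for s t
  proof (rule ccontr)
    assume *: "\<not> ?thesis"
    then obtain x where x: "x \<in> Opt s" "x \<noteq> t" using top_opt[OF s] by blast
    obtain y where y: "y \<in> V" "y \<notin> Opt s" using * OptV[OF s(1)] by blast
    have ne: "y \<noteq> x" "y \<noteq> t" using x y top_opt[OF s] by auto
    have K: "x \<in> {1..k}" "y \<in> {1..k}" "t \<in> {1..k}" using x y OptV[OF s(1)] Vk s(2) by (auto simp: top_def)
    obtain s1 where s1: "s1 \<in> ?L" "\<And>w. w \<in> {1..k} \<Longrightarrow> (w, t) \<in> s1"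
        "\<And>w. w \<in> {1..k} \<Longrightarrow> w \<noteq> t \<Longrightarrow> (w, y) \<in> s1"
      using ex_ranking_with_first_two[OF K(3,2)] ne by blast
    have "top s1 t" using s1(2) s(2) Vk by (auto simp: top_def)
    then have eq: "Opt s1 = Opt s" using Opt_mono s s1(1) by blast
    obtain r where r: "r \<in> ?L" "\<And>w. w \<in> {1..k} \<Longrightarrow> (w, y) \<in> r"
        "\<And>w. w \<in> {1..k} \<Longrightarrow> w \<noteq> y \<Longrightarrow> (w, x) \<in> r"
      using ex_ranking_with_first_two[OF K(2,1)] ne by blast
    have "g r s1 \<in> Opt s1" using r(1) by (auto simp: Opt_def)
    then have 1: "g r s1 = x"
      using best_opt[OF r(1) s1(1)] eq x(1) y(2) r(3) g[OF r(1) s1(1)] rankingsD(4)[OF r(1)] by metis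
    have "top r y" using r(2) y(1) Vk by (auto simp: top_def)
    then have "g r r = y" using unanimous r(1) by blast
    then have "(y, x) \<in> s1" using best2[OF r(1) s1(1) r(1)] 1 by simp
    then show False using s1(3)[OF K(1)] x(2) ne(1) rankingsD(4)[OF s1(1)] by blast
  qed
  \<comment> \<open>If every option set is the whole range, the first voter always gets her best
    value and the second is irrelevant. Otherwise one option set is a proper singleton, which forces
    all of them to be singletons and makes the first voter irrelevant.\<close>
  show ?thesis
  proof (cases "\<forall>s\<in>?L. Opt s = V")
    case True
    have dep: "g r s = g r s'" if "r \<in> ?L" "s \<in> ?L" "s' \<in> ?L" for r s s'
      using best_opt[OF that(1,2)] best_opt[OF that(1,3)] True that gV[OF that(1,2)] gV[OF that(1,3)] rankingsD(4)[OF that(1)]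
      by metis
    show ?thesis by (intro disjI1 ballI) (rule dep; assumption)
  next
    case not_all: False
    then obtain s t where s: "s \<in> ?L" "Opt s \<noteq> V" "top s t" using ex_top by blast
    then have St: "Opt s = {t}" using Opt_dichotomy by blast
    have sing: "Opt s' = {t'}" if s': "s' \<in> ?L" "top s' t'" for s' t'
    proof (rule ccontr)
      assume "Opt s' \<noteq> {t'}"
      then have SV: "Opt s' = V" using Opt_dichotomy[OF s'] by blast
      have "t \<noteq> t'" using Opt_mono[OF s(1) s'(1)] Opt_mono[OF s'(1) s(1)] s(2,3) s'(2) SV by blast
      \<comment> \<open>This is where a third value is used. With the second voter ranking
        \<open>t'\<close> then \<open>t\<close>, all options are open and a first voter with
        favourite \<open>z\<close> gets \<open>z\<close>; by reporting \<open>s\<close> the second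
        voter obtains \<open>t\<close>, which she prefers.\<close>
      obtain z where z: "z \<in> V" "z \<noteq> t" "z \<noteq> t'" using False[unfolded not_ex, rule_format, of t t'] by (auto simp: V_def)
      have K: "t \<in> {1..k}" "t' \<in> {1..k}" "z \<in> {1..k}" using z Vk s(3) s'(2) by (auto simp: top_def)
      obtain s1 where s1: "s1 \<in> ?L" "\<And>w. w \<in> {1..k} \<Longrightarrow> (w, t') \<in> s1"
          "\<And>w. w \<in> {1..k} \<Longrightarrow> w \<noteq> t' \<Longrightarrow> (w, t) \<in> s1"
        using ex_ranking_with_first_two[OF K(2,1)] \<open>t \<noteq> t'\<close> by blast
      have "top s1 t'" using s1(2) s'(2) Vk by (auto simp: top_def)
      then have S1: "Opt s1 = V" using Opt_mono[OF s'(1) s1(1) s'(2)] SV OptV[OF s1(1)] by blast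
      obtain r where r: "r \<in> ?L" "\<And>w. w \<in> {1..k} \<Longrightarrow> (w, z) \<in> r"
        "\<And>w. w \<in> {1..k} \<Longrightarrow> w \<noteq> z \<Longrightarrow> (w, t) \<in> r"
        using ex_ranking_with_first_two[OF K(3,1) z(2)] by blast
      have "g r s1 = z"
        using best_opt[OF r(1) s1(1)] S1 z(1) r(2) g[OF r(1) s1(1)] rankingsD(4)[OF r(1)] by blast
      moreover have "g r s = t" using St r(1) by (auto simp: Opt_def)
      ultimately have "(t, z) \<in> s1" using best2[OF r(1) s1(1) s(1)] by simp
      then show False using s1(3)[OF K(3)] z rankingsD(4)[OF s1(1)] by blast
    qed
    have dep: "g r s = g r' s" if "r \<in> ?L" "r' \<in> ?L" "s \<in> ?L" for r r' s
    proof -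
      from ex_top that obtain t where "top s t" by blast
      then have "Opt s = {t}" using sing that by blast
      then have "g r s \<in> {t}" "g r' s \<in> {t}" using that unfolding Opt_def by blast+
      then show ?thesis by simp
    qed
    show ?thesis by (rule disjI2, rule disjI1, intro ballI) (rule dep; assumption)
  qed
qed blast

section \<open>Counting rankings by relabelling alternatives\<close>

lemma inv_image_ranking:
  assumes "\<pi> permutes {1..k}" "r \<in> rankings k"
  shows "inv_image r \<pi> \<in> rankings k"
proof -
  have mem: "\<pi> a \<in> {1..k} \<longleftrightarrow> a \<in> {1..k}" for a using assms(1) by (rule permutes_in_image)
  have inj: "\<pi> a = \<pi> b \<longleftrightarrow> a = b" for a b using permutes_inj[OF assms(1)] by (auto dest: injD)
  note r = rankingsD[OF assms(2)]
  have "inv_image r \<pi> \<subseteq> {1..k} \<times> {1..k}"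
  proof (rule subrelI)
    fix a b assume "(a, b) \<in> inv_image r \<pi>"
    then have "(\<pi> a, \<pi> b) \<in> {1..k} \<times> {1..k}" using r(1) by (auto simp: inv_image_def)
    then show "(a, b) \<in> {1..k} \<times> {1..k}" using mem by blast
  qed
  moreover have "refl_on {1..k} (inv_image r \<pi>)" using r(2) mem by (simp add: refl_on_def inv_image_def)
  moreover have "trans (inv_image r \<pi>)" using r(3) by (auto intro!: transI simp: inv_image_def)
  moreover have "antisym (inv_image r \<pi>)" using r(4) inj by (auto intro!: antisymI simp: inv_image_def)
  moreover have "total_on {1..k} (inv_image r \<pi>)" 
    using r(5) mem by (simp add: total_on_def inv_image_def)
  ultimately show ?thesis by (simp add: rankings_def order_on_defs)
qed

text \<open>Relabelling by \<open>\<pi>\<close> is a bijection on rankings, with relabelling by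
  \<open>inv \<pi>\<close> as its inverse. The symmetry arguments below all rest on it.\<close>

lemma card_rankings_relabel:
  assumes "\<pi> permutes {1..k}"
  shows "card {r \<in> rankings k. Q (inv_image r \<pi>)} = card {r \<in> rankings k. Q r}"
proof -
  have inv: "inv_image (inv_image r (inv \<pi>)) \<pi> = r" "inv_image (inv_image r \<pi>) (inv \<pi>) = r" for r
    using permutes_inverses[OF assms] by (auto simp: inv_image_def)
  have "bij_betw (\<lambda>r. inv_image r \<pi>) {r \<in> rankings k. Q (inv_image r \<pi>)} {r \<in> rankings k. Q r}"
    by (rule bij_betw_byWitness[where f' = "\<lambda>r. inv_image r (inv \<pi>)"])
      (auto simp: inv intro: inv_image_ranking[OF assms] inv_image_ranking[OF permutes_inv[OF assms]])
  then show ?thesis by (rule bij_betw_same_card)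
qed

lemma ranks_above_inv_image:
  assumes "\<pi> permutes {1..k}"
  shows "ranks_above (inv_image r \<pi>) a b \<longleftrightarrow> ranks_above r (\<pi> a) (\<pi> b)"
  using permutes_inj[OF assms] by (auto simp: ranks_above_def inv_image_def dest: injD)

lemma ranks_above_commute:
  assumes "r \<in> rankings k" "a \<in> {1..k}" "b \<in> {1..k}" "a \<noteq> b"
  shows "ranks_above r b a \<longleftrightarrow> \<not> ranks_above r a b"
  using rankingsD[OF assms(1)] assms(2-4) unfolding ranks_above_def by metis

lemma card_rankings_split:
  "card {r \<in> rankings k. p r} = card {r \<in> rankings k. p r \<and> q r} + card {r \<in> rankings k. p r \<and> \<not> q r}"
  by (subst card_Un_disjoint[symmetric]) (auto simp: finite_rankings intro: arg_cong[where f=card])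

text \<open>Exchanging the names \<open>a\<close> and \<open>b\<close> reverses the preference
  between them.\<close>

lemma card_ranks_above:
  assumes "a \<in> {1..k}" "b \<in> {1..k}" "a \<noteq> b"
  shows "2 * card {r \<in> rankings k. ranks_above r a b} = card (rankings k)"
proof -
  have p: "Transposition.transpose a b permutes {1..k}" using assms by (intro permutes_swap_id)
  have "card {r \<in> rankings k. ranks_above r b a} = card {r \<in> rankings k. ranks_above r a b}"
    using card_rankings_relabel[OF p, of "\<lambda>r. ranks_above r a b"] by (simp add: ranks_above_inv_image[OF p])
  moreover have "{r \<in> rankings k. ranks_above r b a} = {r \<in> rankings k. \<not> ranks_above r a b}"
    using ranks_above_commute assms by blast
  ultimately show ?thesis using card_rankings_split[of k "\<lambda>_. True" "\<lambda>r. ranks_above r a b"] by simp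
qed

lemma card_same_preference:
  assumes "a \<in> {1..k}" "b \<in> {1..k}" "a \<noteq> b"
  shows "card {r \<in> rankings k. ranks_above s a b = ranks_above r a b} = card (rankings k) div 2"
  using card_ranks_above[OF assms] card_rankings_split[of k "\<lambda>_. True" "\<lambda>r. ranks_above r a b"]
  by (cases "ranks_above s a b") auto

text \<open>By symmetry each of the three alternatives is equally often the best of the three. This
  is the case of correlation 1/3.\<close>

lemma card_two_preferences_overlapping:
  assumes "a \<in> {1..k}" "b \<in> {1..k}" "c \<in> {1..k}" "a \<noteq> b" "a \<noteq> c" "b \<noteq> c"
  shows "3 * card {r \<in> rankings k. ranks_above r a b \<and> ranks_above r a c} = card (rankings k)"
proof -
  let ?T = "\<lambda>a b c. {r \<in> rankings k. ranks_above r a b \<and> ranks_above r a c}"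
  have sym: "card (?T v u w) = card (?T u v w)"
    if "u \<in> {1..k}" "v \<in> {1..k}" "u \<noteq> w" "v \<noteq> w" for u v w
  proof -
    have p: "Transposition.transpose u v permutes {1..k}" using that by (intro permutes_swap_id)
    show ?thesis
      using card_rankings_relabel[OF p, of "\<lambda>r. ranks_above r u v \<and> ranks_above r u w"] that
      by (simp add: ranks_above_inv_image[OF p])
  qed
  have un: "rankings k = ?T a b c \<union> ?T b a c \<union> ?T c a b"
  proof -
    have "r \<in> ?T a b c \<union> ?T b a c \<union> ?T c a b" if r: "r \<in> rankings k" for r
    proof -
      obtain t where "t \<in> {a, b, c}" "\<And>y. y \<in> {a, b, c} \<Longrightarrow> (y, t) \<in> r"
        by (rule ranking_has_top[OF r, of "{a, b, c}"]) (use assms in auto)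
      then show ?thesis using r assms(4-6) by (auto simp: ranks_above_def)
    qed
    then show ?thesis by auto
  qed
  have "card (rankings k) = card (?T a b c \<union> ?T b a c) + card (?T c a b)"
    by (subst (1) un, rule card_Un_disjoint)
      (use ranks_above_commute assms in \<open>auto simp: finite_rankings\<close>)
  also have "card (?T a b c \<union> ?T b a c) = card (?T a b c) + card (?T b a c)"
    by (rule card_Un_disjoint) (use ranks_above_commute assms in \<open>auto simp: finite_rankings\<close>)
  also have "card (?T c a b) = card (?T a b c)"
    using sym[of a c b] assms by (simp add: conj_commute)
  also have "card (?T b a c) = card (?T a b c)" using sym[of a b c] assms by simp
  finally show ?thesis by simp
qed

text \<open>Exchanging \<open>a\<close> and \<open>b\<close> leaves the order of \<open>c\<close>
  and \<open>d\<close> alone, so the two preferences are independent.\<close>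

lemma card_two_preferences_disjoint:
  assumes "a \<in> {1..k}" "b \<in> {1..k}" "c \<in> {1..k}" "d \<in> {1..k}" "a \<noteq> b" "c \<noteq> d"
    "c \<noteq> a" "c \<noteq> b" "d \<noteq> a" "d \<noteq> b"
  shows "4 * card {r \<in> rankings k. ranks_above r a b \<and> ranks_above r c d} = card (rankings k)"
proof -
  have p: "Transposition.transpose a b permutes {1..k}" using assms by (intro permutes_swap_id)
  have "card {r \<in> rankings k. ranks_above r b a \<and> ranks_above r c d}
      = card {r \<in> rankings k. ranks_above r a b \<and> ranks_above r c d}"
    using card_rankings_relabel[OF p, of "\<lambda>r. ranks_above r a b \<and> ranks_above r c d"] assms
    by (simp add: ranks_above_inv_image[OF p])
  moreover have "{r \<in> rankings k. ranks_above r b a \<and> ranks_above r c d}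
      = {r \<in> rankings k. ranks_above r c d \<and> \<not> ranks_above r a b}"
    using ranks_above_commute assms by blast
  moreover have "{r \<in> rankings k. ranks_above r a b \<and> ranks_above r c d}
      = {r \<in> rankings k. ranks_above r c d \<and> ranks_above r a b}" by blast
  ultimately show ?thesis
    using card_rankings_split[of k "\<lambda>r. ranks_above r c d" "\<lambda>r. ranks_above r a b"]
      card_ranks_above[OF assms(3,4,6)] by simp
qed

section \<open>Pivotal profiles and two-voter slices\<close>

text \<open>The vote of \<open>i\<close> is overwritten, so it does not affect membership;
  \<open>i\<close> may be able to reach further values outside \<open>X\<close>.\<close>

definition pivot_profiles :: "nat \<Rightarrow> nat \<Rightarrow> ((nat \<Rightarrow> nat rel) \<Rightarrow> nat) \<Rightarrow> nat \<Rightarrow> nat set \<Rightarrow> (nat \<Rightarrow> nat rel) set" where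
  "pivot_profiles n k f i X = {\<sigma> \<in> profiles n k. X \<subseteq> (\<lambda>r. f (\<sigma>(i := r))) ` rankings k}"

text \<open>Membership depends only on the votes outside \<open>i\<close> and \<open>j\<close>. The
  manipulation found in the slice may be due to any voter, so the size is controlled by the number
  of manipulation points alone.\<close>

definition manipulable_slice :: "nat \<Rightarrow> nat \<Rightarrow> ((nat \<Rightarrow> nat rel) \<Rightarrow> nat) \<Rightarrow> nat \<Rightarrow> nat \<Rightarrow> (nat \<Rightarrow> nat rel) set" where
  "manipulable_slice n k f i j = {\<sigma> \<in> profiles n k.
     \<exists>r\<in>rankings k. \<exists>s\<in>rankings k. \<sigma>(i := r, j := s) \<in> manipulation_points n k f}"

lemma profiles_upd:
  assumes "\<sigma> \<in> profiles n k" "i \<in> {1..n}" "r \<in> rankings k"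
  shows "\<sigma>(i := r) \<in> profiles n k"
  using assms by (auto simp: profiles_def PiE_iff extensional_def)

lemma profilesD: "\<sigma> \<in> profiles n k \<Longrightarrow> i \<in> {1..n} \<Longrightarrow> \<sigma> i \<in> rankings k"
  by (auto simp: profiles_def)

lemma SCF_range: "f \<in> SCF n k \<Longrightarrow> \<sigma> \<in> profiles n k \<Longrightarrow> f \<sigma> \<in> {1..k}"
  by (auto simp: SCF_def)

lemma manipulation_points_subset: "manipulation_points n k f \<subseteq> profiles n k"
  by (auto simp: manipulation_points_def manipulation_pair_def)

lemma pivot_profiles_subset: "pivot_profiles n k f i X \<subseteq> profiles n k"
  by (auto simp: pivot_profiles_def)

lemma manipulable_slice_subset: "manipulable_slice n k f i j \<subseteq> profiles n k"
  by (auto simp: manipulable_slice_def)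

lemma pivot_profiles_upd_self: "\<sigma>(i := r) \<in> pivot_profiles n k f i X \<longleftrightarrow> \<sigma> \<in> pivot_profiles n k f i X"
  if "\<sigma> \<in> profiles n k" "i \<in> {1..n}" "r \<in> rankings k"
  using that profiles_upd by (auto simp: pivot_profiles_def)

text \<open>Each member is recovered from some manipulation point by writing back its own votes at
  \<open>i\<close> and \<open>j\<close>, which leaves one choice of a ranking for each of the
  two.\<close>

lemma card_manipulable_slice:
  "card (manipulable_slice n k f i j) \<le> card (rankings k) ^ 2 * card (manipulation_points n k f)"
  if "i \<in> {1..n}" "j \<in> {1..n}"
proof -
  let ?M = "manipulation_points n k f"
  let ?S = "?M \<times> rankings k \<times> rankings k"
  have "manipulable_slice n k f i j \<subseteq> (\<lambda>(\<mu>, r, s). \<mu>(i := r, j := s)) ` ?S"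
  proof
    fix \<sigma> assume "\<sigma> \<in> manipulable_slice n k f i j"
    then obtain r s where rs: "\<sigma> \<in> profiles n k" "r \<in> rankings k" "s \<in> rankings k" "\<sigma>(i := r, j := s) \<in> ?M"
      by (auto simp: manipulable_slice_def)
    have "\<sigma> = (\<sigma>(i := r, j := s))(i := \<sigma> i, j := \<sigma> j)" by auto
    moreover have "\<sigma> i \<in> rankings k" "\<sigma> j \<in> rankings k" using profilesD rs(1) that by blast+
    ultimately show "\<sigma> \<in> (\<lambda>(\<mu>, r, s). \<mu>(i := r, j := s)) ` ?S"
      using rs(4) by (intro image_eqI[of _ _ "(\<sigma>(i := r, j := s), \<sigma> i, \<sigma> j)"]) auto
  qed
  moreover have fin: "finite ?S"
    using finite_subset[OF manipulation_points_subset finite_profiles] finite_rankings by auto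
  ultimately have "card (manipulable_slice n k f i j) \<le> card ?S"
    using surj_card_le by blast
  then show ?thesis by (simp add: card_cartesian_product power2_eq_square mult.commute)
qed

section \<open>Two-voter slices without manipulation points\<close>

context
  fixes n k :: nat and f :: "(nat \<Rightarrow> nat rel) \<Rightarrow> nat" and i j :: nat and \<sigma> :: "nat \<Rightarrow> nat rel"
  assumes f: "f \<in> SCF n k" and ij: "i \<in> {1..n}" "j \<in> {1..n}" "i \<noteq> j"
    and \<sigma>: "\<sigma> \<in> profiles n k" "\<sigma> \<notin> manipulable_slice n k f i j"
begin

lemma slice_profile: "r \<in> rankings k \<Longrightarrow> s \<in> rankings k \<Longrightarrow> \<sigma>(i := r, j := s) \<in> profiles n k"
  using \<sigma>(1) ij by (intro profiles_upd)

lemma slice_strategyproof_first: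
  assumes "r \<in> rankings k" "r' \<in> rankings k" "s \<in> rankings k"
  shows "\<not> ranks_above r (f (\<sigma>(i := r', j := s))) (f (\<sigma>(i := r, j := s)))"
proof
  assume *: "ranks_above r (f (\<sigma>(i := r', j := s))) (f (\<sigma>(i := r, j := s)))"
  then have "r \<noteq> r'" by (auto simp: ranks_above_def)
  then have "manipulation_pair n k f (\<sigma>(i := r, j := s)) (\<sigma>(i := r', j := s))"
    unfolding manipulation_pair_def using * assms slice_profile ij
    by (intro conjI bexI[of _ i]) auto
  then show False using \<sigma> assms by (auto simp: manipulable_slice_def manipulation_points_def)
qed

lemma slice_strategyproof_second:
  assumes "r \<in> rankings k" "s \<in> rankings k" "s' \<in> rankings k"
  shows "\<not> ranks_above s (f (\<sigma>(i := r, j := s'))) (f (\<sigma>(i := r, j := s)))"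
proof
  assume *: "ranks_above s (f (\<sigma>(i := r, j := s'))) (f (\<sigma>(i := r, j := s)))"
  then have "s \<noteq> s'" by (auto simp: ranks_above_def)
  then have "manipulation_pair n k f (\<sigma>(i := r, j := s)) (\<sigma>(i := r, j := s'))"
    unfolding manipulation_pair_def using * assms slice_profile ij
    by (intro conjI bexI[of _ j]) auto
  then show False using \<sigma> assms by (auto simp: manipulable_slice_def manipulation_points_def)
qed

lemma slice_cases:
  obtains
    (first) "\<And>r s s'. r \<in> rankings k \<Longrightarrow> s \<in> rankings k \<Longrightarrow> s' \<in> rankings k \<Longrightarrow>
      f (\<sigma>(i := r, j := s)) = f (\<sigma>(i := r, j := s'))"
  | (second) "\<And>r r' s. r \<in> rankings k \<Longrightarrow> r' \<in> rankings k \<Longrightarrow> s \<in> rankings k \<Longrightarrow>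
      f (\<sigma>(i := r, j := s)) = f (\<sigma>(i := r', j := s))"
  | (two_values) a b where "\<And>r s. r \<in> rankings k \<Longrightarrow> s \<in> rankings k \<Longrightarrow> f (\<sigma>(i := r, j := s)) \<in> {a, b}"
proof -
  have "f (\<sigma>(i := r, j := s)) \<in> {1..k}" if "r \<in> rankings k" "s \<in> rankings k" for r s
    using SCF_range[OF f slice_profile[OF that]] .
  from two_voter_Gibbard_Satterthwaite[of k "\<lambda>r s. f (\<sigma>(i := r, j := s))",
      OF this slice_strategyproof_first slice_strategyproof_second]
  consider "\<forall>r\<in>rankings k. \<forall>s\<in>rankings k. \<forall>s'\<in>rankings k. f (\<sigma>(i := r, j := s)) = f (\<sigma>(i := r, j := s'))"
    | "\<forall>r\<in>rankings k. \<forall>r'\<in>rankings k. \<forall>s\<in>rankings k. f (\<sigma>(i := r, j := s)) = f (\<sigma>(i := r', j := s))"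
    | a b where "\<forall>r\<in>rankings k. \<forall>s\<in>rankings k. f (\<sigma>(i := r, j := s)) \<in> {a, b}"
    by blast
  then show thesis
  proof cases
    case 1
    show thesis by (rule first) (use 1 in \<open>blast\<close>)
  next
    case 2
    show thesis by (rule second) (use 2 in \<open>blast\<close>)
  next
    case (3 a b)
    show thesis by (rule two_values[of a b]) (use 3 in \<open>blast\<close>)
  qed
qed

lemma pivot_first_iff:
  "\<sigma> \<in> pivot_profiles n k f i X \<longleftrightarrow> X \<subseteq> (\<lambda>r. f (\<sigma>(i := r, j := \<sigma> j))) ` rankings k"
proof -
  have "\<sigma>(i := r, j := \<sigma> j) = \<sigma>(i := r)" for r using ij(3) by (auto simp: fun_eq_iff)
  then show ?thesis using \<sigma>(1) by (simp add: pivot_profiles_def)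
qed

lemma pivot_second_iff:
  "\<sigma> \<in> pivot_profiles n k f j X \<longleftrightarrow> X \<subseteq> (\<lambda>s. f (\<sigma>(i := \<sigma> i, j := s))) ` rankings k"
  using \<sigma>(1) by (simp add: pivot_profiles_def)

text \<open>In a manipulation-free slice either one of the voters is irrelevant and cannot reach two
  values, or the slice takes at most two values and both pairs must consist of exactly
  these.\<close>

lemma not_both_pivotal:
  assumes "\<sigma> \<in> pivot_profiles n k f i X" "\<sigma> \<in> pivot_profiles n k f j Y" "card X = 2" "card Y = 2"
  shows "X = Y"
proof -
  note X = assms(1)[unfolded pivot_first_iff] and Y = assms(2)[unfolded pivot_second_iff]
  have \<sigma>ij: "\<sigma> i \<in> rankings k" "\<sigma> j \<in> rankings k" using profilesD \<sigma> ij by blast+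
  have single: "card Z \<noteq> 2" if "Z \<subseteq> {c}" for Z and c :: nat
    using card_mono[OF _ that] by auto
  show ?thesis
  proof (cases rule: slice_cases)
    case first
    have "Y \<subseteq> {f (\<sigma>(i := \<sigma> i, j := \<sigma> j))}" using Y first \<sigma>ij by blast
    then show ?thesis using single assms(4) by blast
  next
    case second
    have "X \<subseteq> {f (\<sigma>(i := \<sigma> i, j := \<sigma> j))}" using X second \<sigma>ij by blast
    then show ?thesis using single assms(3) by blast
  next
    case (two_values a b)
    have "Z = {a, b}" if "Z \<subseteq> {a, b}" "card Z = 2" for Z
      using card_subset_eq[OF _ that(1)] that(2) card_mono[OF _ that(1)] by (cases "a = b") auto
    moreover have "X \<subseteq> {a, b}" "Y \<subseteq> {a, b}" using X Y two_values \<sigma>ij by blast+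
    ultimately show ?thesis using assms(3,4) by blast
  qed
qed

text \<open>If voter \<open>j\<close> is irrelevant on the slice nothing changes, and
  \<open>i\<close> is relevant because she is pivotal. In the remaining case \<open>a\<close> and
  \<open>b\<close> are the only values on the slice, so only the order of these two matters to
  \<open>j\<close>.\<close>

lemma pivot_preserved:
  assumes "\<sigma> \<in> pivot_profiles n k f i {a, b}" "a \<noteq> b" "t \<in> rankings k"
    and same: "ranks_above (\<sigma> j) a b = ranks_above t a b"
  shows "\<sigma>(j := t) \<in> pivot_profiles n k f i {a, b}"
proof -
  note X = assms(1)[unfolded pivot_first_iff]
  have \<sigma>j: "\<sigma> j \<in> rankings k" using profilesD \<sigma> ij by blast
  have "f (\<sigma>(i := r, j := \<sigma> j)) = f (\<sigma>(i := r, j := t))" if r: "r \<in> rankings k" for r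
  proof (cases rule: slice_cases)
    case first
    then show ?thesis using r \<sigma>j assms(3) by blast
  next
    case second
    have "{a, b} \<subseteq> {f (\<sigma>(i := r, j := \<sigma> j))}" using X second[OF _ r \<sigma>j] by blast
    then show ?thesis using assms(2) by blast
  next
    case (two_values c d)
    let ?u = "f (\<sigma>(i := r, j := \<sigma> j))" and ?v = "f (\<sigma>(i := r, j := t))"
    have "{a, b} \<subseteq> {c, d}" using X two_values \<sigma>j by blast
    then have "{c, d} = {a, b}" using assms(2) by auto
    then have uv: "?u \<in> {a, b}" "?v \<in> {a, b}" using two_values[OF r] \<sigma>j assms(3) by blast+
    have K: "a \<in> {1..k}" "b \<in> {1..k}" using X SCF_range[OF f slice_profile[OF _ \<sigma>j]] by blast+
    \<comment> \<open>As both rankings of \<open>j\<close> order \<open>a\<close> and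
      \<open>b\<close> alike, two different outcomes would make the move an improvement in one
      direction or the other.\<close>
    have "\<not> ranks_above (\<sigma> j) ?v ?u" "\<not> ranks_above t ?u ?v"
      using slice_strategyproof_second[OF r \<sigma>j assms(3)] slice_strategyproof_second[OF r assms(3) \<sigma>j] .
    then show ?thesis
      using uv same ranks_above_commute[OF \<sigma>j K assms(2)] ranks_above_commute[OF assms(3) K assms(2)]
      by (elim insertE emptyE) auto
  qed
  then have "{a, b} \<subseteq> (\<lambda>r. f (\<sigma>(i := r, j := t))) ` rankings k" using X by auto
  moreover have "\<sigma>(i := r, j := t) = \<sigma>(j := t, i := r)" for r using ij(3) by (simp add: fun_upd_twist)
  ultimately show ?thesis using \<sigma>(1) ij assms(3) by (simp add: pivot_profiles_def profiles_upd)
qed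

end

section \<open>Pivotal sets as approximate functions of two-way preferences\<close>

text \<open>Round \<open>U\<close> to a union of classes of \<open>R\<close> by majority vote within
  each class. A point where \<open>U\<close> and its rounding differ is in the minority, or tied, in
  its class and so disagrees with at least \<open>m / 2\<close> members; counting disagreeing pairs
  gives the factor 2.\<close>

lemma majority_approximation:
  fixes R :: "'a \<Rightarrow> 'a \<Rightarrow> bool"
  assumes fin: "finite P" and m: "m > 0"
    and fib: "\<And>\<sigma>. \<sigma> \<in> P \<Longrightarrow> card {\<tau> \<in> P. R \<sigma> \<tau>} = m"
    and equiv: "\<And>\<sigma> \<tau> \<rho>. R \<sigma> \<tau> \<Longrightarrow> R \<sigma> \<rho> = R \<tau> \<rho>"
    and U: "U \<subseteq> P" and few: "card {(\<sigma>, \<tau>). \<sigma> \<in> P \<and> \<tau> \<in> P \<and> R \<sigma> \<tau> \<and> (\<sigma> \<in> U) \<noteq> (\<tau> \<in> U)} \<le> m * c"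
  obtains A where "A \<subseteq> P" "\<And>\<sigma> \<tau>. \<sigma> \<in> A \<Longrightarrow> \<tau> \<in> P \<Longrightarrow> R \<sigma> \<tau> \<Longrightarrow> \<tau> \<in> A"
    "card (U - A) \<le> 2 * c" "card (A - U) \<le> 2 * c"
proof
  define A where "A = {\<sigma> \<in> P. m \<le> 2 * card {\<tau> \<in> P. R \<sigma> \<tau> \<and> \<tau> \<in> U}}"
  define D where "D \<sigma> = {\<tau> \<in> P. R \<sigma> \<tau> \<and> (\<sigma> \<in> U) \<noteq> (\<tau> \<in> U)}" for \<sigma>
  show "A \<subseteq> P" by (auto simp: A_def)
  show "\<tau> \<in> A" if "\<sigma> \<in> A" "\<tau> \<in> P" "R \<sigma> \<tau>" for \<sigma> \<tau>
    using that equiv[OF that(3)] by (simp add: A_def)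
  have split: "m = card {\<tau> \<in> P. R \<sigma> \<tau> \<and> \<tau> \<in> U} + card {\<tau> \<in> P. R \<sigma> \<tau> \<and> \<tau> \<notin> U}" if "\<sigma> \<in> P" for \<sigma>
    unfolding fib[OF that, symmetric] using fin
    by (subst card_Un_disjoint[symmetric]) (auto intro: arg_cong[where f=card])
  have D: "m \<le> 2 * card (D \<sigma>)" if "\<sigma> \<in> (U - A) \<union> (A - U)" for \<sigma>
    using that U split[of \<sigma>] by (auto simp: A_def D_def)
  \<comment> \<open>Stated for an arbitrary part of the symmetric difference, so that it covers both
    one-sided differences.\<close>
  have *: "card S \<le> 2 * c" if "S \<subseteq> (U - A) \<union> (A - U)" for S
  proof -
    have SP: "S \<subseteq> P" using that U by (auto simp: A_def)
    have finS: "finite S" using SP fin finite_subset by blast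
    have "m * card S \<le> (\<Sum>\<sigma>\<in>S. 2 * card (D \<sigma>))"
      using D that by (subst mult.commute) (rule sum_bounded_below[where 'a=nat, simplified]; blast)
    also have "\<dots> = 2 * card (Sigma S D)"
      using fin finS by (subst card_SigmaI) (auto simp: D_def sum_distrib_left)
    also have "\<dots> \<le> 2 * (m * c)"
    proof -
      have "card (Sigma S D) \<le> card {(\<sigma>, \<tau>). \<sigma> \<in> P \<and> \<tau> \<in> P \<and> R \<sigma> \<tau> \<and> (\<sigma> \<in> U) \<noteq> (\<tau> \<in> U)}"
        using SP by (intro card_mono) (auto simp: D_def intro: finite_subset[of _ "P \<times> P"] fin)
      then show ?thesis using few by simp
    qed
    finally show ?thesis using m by simp
  qed
  show "card (U - A) \<le> 2 * c" "card (A - U) \<le> 2 * c" by (auto intro: *)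
qed

lemma card_profiles: "card (profiles n k) = card (rankings k) ^ n"
  by (simp add: profiles_def card_PiE)

lemma card_rankings_pos: "card (rankings k) > 0"
  using finite_rankings rankings_nonempty by (simp add: card_gt_0_iff)

text \<open>Counting, for each alternative, those ranked no higher turns a ranking into a permutation.\<close>
lemma card_rankings_le_fact: "card (rankings k) \<le> fact k"
proof -
  \<comment> \<open>Off \<open>{1..k}\<close> the map is the identity, as \<open>permutes\<close>
    demands.\<close>
  define h where "h r z = (if z \<in> {1..k} then card {y. (y, z) \<in> r} else z)" for r :: "nat rel" and z
  have fin: "finite {y. (y, b) \<in> r}" if "r \<in> rankings k" for r b
    by (rule finite_subset[of _ "{1..k}"]) (use rankingsD(1)[OF that] in auto)
  have less: "h r a < h r b" if r: "r \<in> rankings k" and ab: "(a, b) \<in> r" "a \<noteq> b" for r a b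
  proof -
    have K: "a \<in> {1..k}" "b \<in> {1..k}" using ab(1) rankingsD(1)[OF r] by blast+
    have "{y. (y, a) \<in> r} \<subset> {y. (y, b) \<in> r}"
      using rankingsD(3)[OF r _ ab(1)] rankingsD(4)[OF r ab(1)] rankingsD(2)[OF r K(2)] ab(2) by blast
    then show ?thesis using psubset_card_mono[OF fin[OF r]] K by (simp add: h_def)
  qed
  have iff: "(a, b) \<in> r \<longleftrightarrow> h r a \<le> h r b" if r: "r \<in> rankings k" and K: "a \<in> {1..k}" "b \<in> {1..k}" for r a b
    using less[OF r] rankingsD(2)[OF r K(1)] rankingsD(5)[OF r K] by (metis leD less_imp_le order_refl)
  have perm: "h r permutes {1..k}" if r: "r \<in> rankings k" for r
  proof -
    have "inj_on (h r) {1..k}"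
      using iff[OF r] rankingsD(4)[OF r] by (intro inj_onI) (metis order_refl)
    moreover have "h r ` {1..k} \<subseteq> {1..k}"
    proof
      fix x assume "x \<in> h r ` {1..k}"
      then obtain z where z: "z \<in> {1..k}" "x = card {y. (y, z) \<in> r}" by (auto simp: h_def)
      have "card {y. (y, z) \<in> r} \<le> card {1..k}"
        by (rule card_mono) (use rankingsD(1)[OF r] in auto)
      moreover have "card {y. (y, z) \<in> r} > 0"
        using fin[OF r] rankingsD(2)[OF r z(1)] by (auto simp: card_gt_0_iff)
      ultimately show "x \<in> {1..k}" using z(2) by simp
    qed
    ultimately have "bij_betw (h r) {1..k} {1..k}"
      by (simp add: bij_betw_def endo_inj_surj)
    then show ?thesis by (rule bij_imp_permutes) (simp add: h_def del: atLeastAtMost_iff)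
  qed
  have "inj_on h (rankings k)"
  proof (rule inj_onI)
    fix r s assume rs: "r \<in> rankings k" "s \<in> rankings k" "h r = h s"
    have "t = {(a, b). a \<in> {1..k} \<and> b \<in> {1..k} \<and> h t a \<le> h t b}" if "t \<in> rankings k" for t
      using iff[OF that] rankingsD(1)[OF that] by auto
    from this[OF rs(1)] this[OF rs(2)] show "r = s" unfolding rs(3) by simp
  qed
  then have "card (rankings k) \<le> card {p. p permutes {1..k}}"
    by (rule card_inj_on_le) (use perm in \<open>auto intro: finite_permutations\<close>)
  then show ?thesis by (simp add: card_permutations)
qed

text \<open>Resample all votes conditioned on every voter's order of \<open>a\<close> and
  \<open>b\<close>. By \<open>pivot_preserved\<close> a step at \<open>j\<close> changes pivotality
  only at a manipulable slice, so few pairs disagree and the majority rounding \<open>A\<close> is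
  close to the pivotal set.\<close>

lemma pivot_profiles_majority:
  assumes f: "f \<in> SCF n k" and i: "i \<in> {1..n}" and ab: "a \<in> {1..k}" "b \<in> {1..k}" "a \<noteq> b"
  obtains A where "A \<subseteq> profiles n k"
    "\<forall>\<sigma>\<in>A. \<forall>\<tau>\<in>profiles n k. (\<forall>j\<in>{1..n}. ranks_above (\<sigma> j) a b = ranks_above (\<tau> j) a b) \<longrightarrow> \<tau> \<in> A"
    "card (pivot_profiles n k f i {a, b} - A) \<le> 2 * (n * (card (rankings k) ^ 2 * card (manipulation_points n k f)))"
    "card (A - pivot_profiles n k f i {a, b}) \<le> 2 * (n * (card (rankings k) ^ 2 * card (manipulation_points n k f)))"
proof -
  let ?c = "card (rankings k) ^ 2 * card (manipulation_points n k f)"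
  let ?E = "\<lambda>j (x :: nat rel) y. ranks_above x a b = ranks_above y a b"
  let ?R = "\<lambda>\<sigma> \<tau>. \<forall>j\<in>{1..n}. ?E j (\<sigma> j) (\<tau> j)"
  let ?U = "pivot_profiles n k f i {a, b}"
  define m where "m = (card (rankings k) div 2) ^ n"
  \<comment> \<open>A step at \<open>i\<close> itself costs nothing, because pivotality for
    \<open>i\<close> ignores her own vote.\<close>
  define W where "W j = (if j = i then {} else manipulable_slice n k f i j)" for j
  have m: "m > 0" using card_rankings_pos[of k] unfolding m_def
    by (simp flip: card_ranks_above[OF ab])
  have fib: "card {\<tau> \<in> profiles n k. ?R \<sigma> \<tau>} = m" for \<sigma>
  proof -
    have "{\<tau> \<in> profiles n k. ?R \<sigma> \<tau>} = (\<Pi>\<^sub>E j\<in>{1..n}. {r \<in> rankings k. ?E j (\<sigma> j) r})"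
      unfolding profiles_def by (rule set_eqI) (simp add: PiE_iff, blast)
    then show ?thesis by (simp add: card_PiE card_same_preference[OF ab] m_def)
  qed
  have "card {(\<sigma>, \<tau>). \<sigma> \<in> profiles n k \<and> \<tau> \<in> profiles n k \<and> ?R \<sigma> \<tau> \<and> (\<sigma> \<in> ?U) \<noteq> (\<tau> \<in> ?U)}
      \<le> m * (\<Sum>j\<in>{1..n}. card (W j))"
    unfolding profiles_def
  proof (rule resampling_bound; (fold profiles_def)?)
    fix j \<sigma> \<tau>
    assume j: "j \<in> {1..n}" and st: "\<sigma> \<in> profiles n k" "\<tau> \<in> profiles n k" and R: "?R \<sigma> \<tau>"
      and ne: "(\<sigma> \<in> ?U) \<noteq> (\<sigma>(j := \<tau> j) \<in> ?U)"
    have r: "\<sigma> j \<in> rankings k" "\<tau> j \<in> rankings k" using profilesD st j by blast+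
    have "j \<noteq> i" using ne pivot_profiles_upd_self[OF st(1) j r(2)] by auto
    moreover have "\<sigma> \<in> manipulable_slice n k f i j"
    proof (rule ccontr)
      assume no: "\<sigma> \<notin> manipulable_slice n k f i j"
      define \<rho> where "\<rho> = \<sigma>(j := \<tau> j)"
      have \<rho>: "\<rho> \<in> profiles n k" using profiles_upd[OF st(1) j r(2)] by (simp add: \<rho>_def)
      \<comment> \<open>Both profiles span the same two-voter slice, so
        \<open>pivot_preserved\<close> applies in either direction.\<close>
      have "\<rho>(i := x, j := y) = \<sigma>(i := x, j := y)" for x y
        using \<open>j \<noteq> i\<close> by (auto simp: \<rho>_def fun_eq_iff)
      then have no': "\<rho> \<notin> manipulable_slice n k f i j"
        using no st(1) by (simp add: manipulable_slice_def)
      have "\<sigma> \<in> ?U \<Longrightarrow> \<rho> \<in> ?U"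
        unfolding \<rho>_def
        using pivot_preserved[OF f i j \<open>j \<noteq> i\<close>[symmetric] st(1) no _ ab(3) r(2)] R j by blast
      moreover have "\<rho> \<in> ?U \<Longrightarrow> \<rho>(j := \<sigma> j) \<in> ?U"
        using pivot_preserved[OF f i j \<open>j \<noteq> i\<close>[symmetric] \<rho> no' _ ab(3) r(1)] R j by (simp add: \<rho>_def)
      moreover have "\<rho>(j := \<sigma> j) = \<sigma>" by (simp add: \<rho>_def)
      ultimately show False using ne by (auto simp: \<rho>_def)
    qed
    ultimately show "\<sigma> \<in> W j" by (simp add: W_def)
  qed (use fib manipulable_slice_subset in \<open>auto simp: finite_rankings W_def\<close>)
  also have "\<dots> \<le> m * (\<Sum>j\<in>{1..n}. ?c)"
    using card_manipulable_slice[OF i] by (intro mult_le_mono2 sum_mono) (auto simp: W_def)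
  finally have few: "card {(\<sigma>, \<tau>). \<sigma> \<in> profiles n k \<and> \<tau> \<in> profiles n k \<and> ?R \<sigma> \<tau> \<and> (\<sigma> \<in> ?U) \<noteq> (\<tau> \<in> ?U)}
      \<le> m * (n * ?c)" by simp
  show thesis
  proof (rule majority_approximation[OF finite_profiles m fib _ pivot_profiles_subset few])
    show "?R \<sigma> \<rho> = ?R \<tau> \<rho>" if "?R \<sigma> \<tau>" for \<sigma> \<tau> \<rho> :: "nat \<Rightarrow> nat rel" using that by auto
  qed (rule that; blast)
qed

text \<open>Pairs that share an alternative are oriented to start with it, giving joint frequency
  1/3; disjoint pairs give 1/4. Both lie in the window from 1/8 to 3/8 that
  \<open>correlated_intersection\<close> requires.\<close>

lemma pivot_pairs_orientation:
  assumes X: "X \<subseteq> {1..k}" "card X = 2" and Y: "Y \<subseteq> {1..k}" "card Y = 2" and "X \<noteq> Y"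
  obtains a b c d where "X = {a, b}" "Y = {c, d}" "a \<noteq> b" "c \<noteq> d"
    "card (rankings k) \<le> 8 * card {r \<in> rankings k. ranks_above r a b \<and> ranks_above r c d}"
    "8 * card {r \<in> rankings k. ranks_above r a b \<and> ranks_above r c d} \<le> 3 * card (rankings k)"
proof (cases "X \<inter> Y = {}")
  case True
  obtain a b where ab: "X = {a, b}" "a \<noteq> b" using X(2) by (auto simp: card_2_iff)
  obtain c d where cd: "Y = {c, d}" "c \<noteq> d" using Y(2) by (auto simp: card_2_iff)
  have "4 * card {r \<in> rankings k. ranks_above r a b \<and> ranks_above r c d} = card (rankings k)"
    by (rule card_two_preferences_disjoint) (use X(1) Y(1) True in \<open>auto simp: ab cd simp del: atLeastAtMost_iff\<close>)
  then show thesis using that[OF ab(1) cd(1) ab(2) cd(2)] by simp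
next
  case False
  then obtain a where a: "a \<in> X" "a \<in> Y" by auto
  obtain b where ab: "X = {a, b}" "a \<noteq> b" using X(2) a by (auto simp: card_2_iff)
  obtain d where ad: "Y = {a, d}" "a \<noteq> d" using Y(2) a by (auto simp: card_2_iff)
  have "3 * card {r \<in> rankings k. ranks_above r a b \<and> ranks_above r a d} = card (rankings k)"
    by (rule card_two_preferences_overlapping) (use X(1) Y(1) ab ad \<open>X \<noteq> Y\<close> in auto)
  then show thesis using that[OF ab(1) ad(1) ab(2) ad(2)] by simp
qed

text \<open>The sets rounded from the two pivotal sets are large, so by
  \<open>correlated_intersection\<close> they meet in many profiles; but most common profiles would
  be pivotal for both voters, which only a manipulable slice permits.\<close>

lemma two_pivots_force_manipulation:
  fixes u :: real
  assumes f: "f \<in> SCF n k" and ij: "i \<in> {1..n}" "j \<in> {1..n}" "i \<noteq> j"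
    and X: "X \<subseteq> {1..k}" "card X = 2" and Y: "Y \<subseteq> {1..k}" "card Y = 2" and "X \<noteq> Y"
    and u: "u \<le> card (pivot_profiles n k f i X)" "u \<le> card (pivot_profiles n k f j Y)"
    and M: "M = real (card (rankings k)) ^ 2 * real (card (manipulation_points n k f))"
    and small: "2 * real n * M \<le> u"
  shows "(u - 2 * real n * M) ^ 4 \<le> (4 * real n + 1) * M * real (card (profiles n k)) ^ 3"
proof -
  let ?U = "pivot_profiles n k f i X" and ?V = "pivot_profiles n k f j Y"
  let ?c = "2 * (n * (card (rankings k) ^ 2 * card (manipulation_points n k f)))"
  have c: "real ?c = 2 * real n * M" by (simp add: M)
  obtain a b c d where abcd: "X = {a, b}" "Y = {c, d}" "a \<noteq> b" "c \<noteq> d"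
    and corr: "card (rankings k) \<le> 8 * card {r \<in> rankings k. ranks_above r a b \<and> ranks_above r c d}"
    "8 * card {r \<in> rankings k. ranks_above r a b \<and> ranks_above r c d} \<le> 3 * card (rankings k)"
    by (rule pivot_pairs_orientation[OF X Y \<open>X \<noteq> Y\<close>])
  have K: "a \<in> {1..k}" "b \<in> {1..k}" "c \<in> {1..k}" "d \<in> {1..k}" using X Y abcd by auto
  obtain A where A: "A \<subseteq> profiles n k"
    "\<forall>\<sigma>\<in>A. \<forall>\<tau>\<in>profiles n k. (\<forall>j\<in>{1..n}. ranks_above (\<sigma> j) a b = ranks_above (\<tau> j) a b) \<longrightarrow> \<tau> \<in> A"
    "card (?U - A) \<le> ?c" "card (A - ?U) \<le> ?c"
    by (rule pivot_profiles_majority[OF f ij(1) K(1,2) abcd(3), folded abcd(1)])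
  obtain B where B: "B \<subseteq> profiles n k"
    "\<forall>\<sigma>\<in>B. \<forall>\<tau>\<in>profiles n k. (\<forall>j\<in>{1..n}. ranks_above (\<sigma> j) c d = ranks_above (\<tau> j) c d) \<longrightarrow> \<tau> \<in> B"
    "card (?V - B) \<le> ?c" "card (B - ?V) \<le> ?c"
    by (rule pivot_profiles_majority[OF f ij(2) K(3,4) abcd(4), folded abcd(2)])
  have finA: "finite A" and finB: "finite B" using A(1) B(1) finite_profiles finite_subset by blast+
  have le: "u - 2 * real n * M \<le> card S" if "u \<le> card Z" "card (Z - S) \<le> ?c" "finite S" for S Z :: "(nat \<Rightarrow> nat rel) set"
  proof -
    have "card Z \<le> card S + card (Z - S)"
    proof (cases "finite Z")
      case True
      then have "card Z \<le> card (S \<union> (Z - S))" using that(3) by (intro card_mono) auto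
      also have "\<dots> \<le> card S + card (Z - S)" by (rule card_Un_le)
      finally show ?thesis .
    qed simp
    then have "real (card Z) \<le> card S + real ?c" using that(2) by linarith
    then show ?thesis using that(1) c by linarith
  qed
  \<comment> \<open>Each of the two roundings contributes an error \<open>2 * n * M\<close>, and the
    manipulable slice contributes \<open>M\<close>.\<close>
  have AB: "real (card (A \<inter> B)) \<le> (4 * real n + 1) * M"
  proof -
    have "?U \<inter> ?V \<subseteq> manipulable_slice n k f i j"
      using not_both_pivotal[OF f ij] X(2) Y(2) \<open>X \<noteq> Y\<close> pivot_profiles_subset by blast
    then have "A \<inter> B \<subseteq> (A - ?U) \<union> (B - ?V) \<union> manipulable_slice n k f i j" by blast
    then have "card (A \<inter> B) \<le> card ((A - ?U) \<union> (B - ?V) \<union> manipulable_slice n k f i j)"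
      using finA finB finite_subset[OF manipulable_slice_subset finite_profiles] by (intro card_mono) auto
    also have "\<dots> \<le> card (A - ?U) + card (B - ?V) + card (manipulable_slice n k f i j)"
      using card_Un_le[of "(A - ?U) \<union> (B - ?V)"] card_Un_le[of "A - ?U" "B - ?V"] by (meson add_mono le_trans order_refl)
    also have "\<dots> \<le> ?c + ?c + card (rankings k) ^ 2 * card (manipulation_points n k f)"
      using A(4) B(4) card_manipulable_slice[OF ij(1,2)] by (intro add_mono)
    finally have "real (card (A \<inter> B)) \<le> real ?c + real ?c + M" unfolding M by (simp flip: of_nat_mult of_nat_add of_nat_power)
    then show ?thesis unfolding c by (simp add: algebra_simps)
  qed
  have "(u - 2 * real n * M) ^ 4 = (u - 2 * real n * M)\<^sup>2 * (u - 2 * real n * M)\<^sup>2" by (simp flip: power_add)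
  also have "\<dots> \<le> (real (card A))\<^sup>2 * (real (card B))\<^sup>2"
    using le[OF u(1) A(3) finA] le[OF u(2) B(3) finB] small by (intro mult_mono power_mono) auto
  also have "\<dots> \<le> real (card (A \<inter> B)) * real (card (rankings k)) ^ (3 * card {1..n})"
  proof (rule correlated_intersection[where x = "\<lambda>r. ranks_above r a b" and y = "\<lambda>r. ranks_above r c d"];
      (fold profiles_def)?)
    show "\<tau> \<in> A" if "\<sigma> \<in> A" "\<tau> \<in> profiles n k" "\<forall>i\<in>{1..n}. ranks_above (\<sigma> i) a b = ranks_above (\<tau> i) a b" for \<sigma> \<tau>
      using A(2) that by blast
    show "\<tau> \<in> B" if "\<sigma> \<in> B" "\<tau> \<in> profiles n k" "\<forall>i\<in>{1..n}. ranks_above (\<sigma> i) c d = ranks_above (\<tau> i) c d" for \<sigma> \<tau>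
      using B(2) that by blast
  qed (use corr card_ranks_above[OF K(1,2) abcd(3)] card_ranks_above[OF K(3,4) abcd(4)] A(1) B(1)
    in \<open>simp_all add: finite_rankings\<close>)
  also have "\<dots> = real (card (A \<inter> B)) * real (card (profiles n k)) ^ 3"
    by (simp add: card_profiles power_mult mult.commute flip: power_mult)
  also have "\<dots> \<le> (4 * real n + 1) * M * real (card (profiles n k)) ^ 3"
    using AB by (intro mult_right_mono) auto
  finally show ?thesis .
qed

section \<open>Functions far from the nonmanipulable ones\<close>

abbreviation alternative_pairs :: "nat \<Rightarrow> nat set set" where
  "alternative_pairs k \<equiv> {X. X \<subseteq> {1..k} \<and> card X = 2}"

lemma finite_alternative_pairs: "finite (alternative_pairs k)"
  by (rule finite_subset[of _ "Pow {1..k}"]) auto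

lemma changed_value_pivot:
  assumes f: "f \<in> SCF n k" and "\<sigma> \<in> profiles n k" "j \<in> {1..n}" "r \<in> rankings k" "f \<sigma> \<noteq> f (\<sigma>(j := r))"
  shows "{f \<sigma>, f (\<sigma>(j := r))} \<in> alternative_pairs k" "\<sigma> \<in> pivot_profiles n k f j {f \<sigma>, f (\<sigma>(j := r))}"
proof -
  show "{f \<sigma>, f (\<sigma>(j := r))} \<in> alternative_pairs k"
    using SCF_range[OF f assms(2)] SCF_range[OF f profiles_upd[OF assms(2-4)]] assms(5) by auto
  have "f \<sigma> = f (\<sigma>(j := \<sigma> j))" by simp
  then have "f \<sigma> \<in> (\<lambda>r. f (\<sigma>(j := r))) ` rankings k" using profilesD[OF assms(2,3)] by blast
  then show "\<sigma> \<in> pivot_profiles n k f j {f \<sigma>, f (\<sigma>(j := r))}"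
    using assms(2,4) by (auto simp: pivot_profiles_def)
qed

lemma card_UN_pivot_le:
  "Q \<subseteq> alternative_pairs k \<Longrightarrow> card (\<Union>X\<in>Q. pivot_profiles n k f j X) \<le> (\<Sum>X\<in>Q. card (pivot_profiles n k f j X))"
  using finite_subset[OF _ finite_alternative_pairs] by (intro card_UN_le) auto

text \<open>Compare \<open>f\<close> with the dictatorial function \<open>g\<close> that picks the
  most frequent value of \<open>f\<close> given the vote of \<open>i\<close>. Its error is at most
  the disagreement of \<open>f\<close> between two profiles sharing that vote, and a walk between
  such profiles never moves coordinate \<open>i\<close>.\<close>

lemma far_from_dictator_pivots:
  assumes f: "f \<in> SCF n k" and i: "i \<in> {1..n}" and k: "k \<ge> 1"
    and far: "\<And>g. g \<in> SCF n k \<Longrightarrow> depends_on_one_coordinate n k g \<Longrightarrow> D \<le> card {\<sigma> \<in> profiles n k. f \<sigma> \<noteq> g \<sigma>}"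
  shows "D \<le> (\<Sum>j\<in>{1..n} - {i}. \<Sum>X\<in>alternative_pairs k. card (pivot_profiles n k f j X))"
proof -
  let ?P = "profiles n k"
  define count where "count r v = card {\<tau> \<in> ?P. r = \<tau> i \<and> f \<tau> = v}" for r v
  have "\<exists>v\<in>{1..k}. \<forall>w\<in>{1..k}. count r w \<le> count r v" for r
  proof -
    have ne: "count r ` {1..k} \<noteq> {}" using k by simp
    have "Max (count r ` {1..k}) \<in> count r ` {1..k}" by (rule Max_in) (use ne in auto)
    then obtain v where "v \<in> {1..k}" "Max (count r ` {1..k}) = count r v" by auto
    then show ?thesis by (metis Max_ge finite_atLeastAtMost finite_imageI imageI)
  qed
  then obtain v where v: "\<And>r. v r \<in> {1..k}" "\<And>r w. w \<in> {1..k} \<Longrightarrow> count r w \<le> count r (v r)"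
    by metis
  \<comment> \<open>the most frequent value of \<open>f\<close> given the ranking of voter \<open>i\<close>\<close>
  define g where "g = (\<lambda>\<sigma>\<in>?P. v (\<sigma> i))"
  have gS: "g \<in> SCF n k" using v(1) by (auto simp: SCF_def g_def simp del: atLeastAtMost_iff)
  have "depends_on_one_coordinate n k g"
    unfolding depends_on_one_coordinate_def by (intro bexI[OF _ i]) (auto simp: g_def)
  then have D: "D \<le> card {\<sigma> \<in> ?P. f \<sigma> \<noteq> g \<sigma>}" using far gS by blast
  \<comment> \<open>The resampling keeps coordinate \<open>i\<close> and leaves all others
    free.\<close>
  let ?E = "\<lambda>j x y. j = i \<longrightarrow> x = (y :: nat rel)"
  let ?R = "\<lambda>\<sigma> \<tau>. \<forall>j\<in>{1..n}. ?E j (\<sigma> j) (\<tau> j)"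
  have R: "?R \<sigma> \<tau> \<longleftrightarrow> \<sigma> i = \<tau> i" for \<sigma> \<tau> using i by auto
  define m where "m = card (rankings k) ^ (n - 1)"
  have m: "m > 0" using card_rankings_pos by (simp add: m_def)
  have fib: "card {\<tau> \<in> ?P. \<sigma> i = \<tau> i} = m" if "\<sigma> \<in> ?P" for \<sigma>
  proof -
    have "{\<tau> \<in> ?P. \<sigma> i = \<tau> i} = (\<Pi>\<^sub>E j\<in>{1..n}. if j = i then {\<sigma> i} else rankings k)"
    proof (rule set_eqI)
      fix \<tau>
      show "\<tau> \<in> {\<tau> \<in> ?P. \<sigma> i = \<tau> i} \<longleftrightarrow> \<tau> \<in> (\<Pi>\<^sub>E j\<in>{1..n}. if j = i then {\<sigma> i} else rankings k)"
        using profilesD[OF that i] i unfolding profiles_def PiE_iff mem_Collect_eq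
        by (metis singleton_iff)
    qed
    then have "card {\<tau> \<in> ?P. \<sigma> i = \<tau> i} = (\<Prod>j\<in>{1..n}. if j = i then 1 else card (rankings k))"
      by (simp add: card_PiE if_distrib[of card] cong: if_cong)
    also have "\<dots> = (\<Prod>j\<in>{1..n} - {i}. card (rankings k))"
      using i by (subst prod.remove[of _ i]) auto
    also have "\<dots> = m" using i by (simp add: m_def)
    finally show ?thesis .
  qed
  define W where "W j = (if j = i then {} else \<Union>X\<in>alternative_pairs k. pivot_profiles n k f j X)" for j
  have W_sub: "W j \<subseteq> ?P" for j by (auto simp: W_def pivot_profiles_def)
  \<comment> \<open>Double counting: every error profile lies in the fibres of exactly
    \<open>m\<close> profiles.\<close>
  have "m * card {\<sigma> \<in> ?P. f \<sigma> \<noteq> g \<sigma>} = (\<Sum>\<sigma>\<in>?P. card {\<tau> \<in> {\<tau> \<in> ?P. f \<tau> \<noteq> g \<tau>}. \<sigma> i = \<tau> i})"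
  proof -
    have "card {\<sigma> \<in> ?P. \<sigma> i = \<tau> i} = m" if "\<tau> \<in> {\<tau> \<in> ?P. f \<tau> \<noteq> g \<tau>}" for \<tau>
      using fib[of \<tau>] that by (simp add: eq_commute)
    then have "(\<Sum>\<sigma>\<in>?P. card {\<tau> \<in> {\<tau> \<in> ?P. f \<tau> \<noteq> g \<tau>}. \<sigma> i = \<tau> i}) = (\<Sum>\<tau>\<in>{\<tau> \<in> ?P. f \<tau> \<noteq> g \<tau>}. m)"
      by (intro sum_multicount_gen) (auto simp: finite_profiles)
    then show ?thesis by simp
  qed
  \<comment> \<open>Within a fibre no guess errs less often than the most frequent value, in
    particular not the guess \<open>f \<sigma>\<close>.\<close>
  also have "\<dots> \<le> (\<Sum>\<sigma>\<in>?P. card {\<tau> \<in> ?P. \<sigma> i = \<tau> i \<and> f \<sigma> \<noteq> f \<tau>})"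
  proof (rule sum_mono)
    fix \<sigma> assume \<sigma>: "\<sigma> \<in> ?P"
    have split: "m = count (\<sigma> i) w + card {\<tau> \<in> ?P. \<sigma> i = \<tau> i \<and> w \<noteq> f \<tau>}" for w
      unfolding fib[OF \<sigma>, symmetric] count_def
      by (subst card_Un_disjoint[symmetric]) (auto simp: finite_profiles intro: arg_cong[where f=card])
    have "{\<tau> \<in> {\<tau> \<in> ?P. f \<tau> \<noteq> g \<tau>}. \<sigma> i = \<tau> i} = {\<tau> \<in> ?P. \<sigma> i = \<tau> i \<and> v (\<sigma> i) \<noteq> f \<tau>}"
      by (auto simp: g_def)
    then show "card {\<tau> \<in> {\<tau> \<in> ?P. f \<tau> \<noteq> g \<tau>}. \<sigma> i = \<tau> i} \<le> card {\<tau> \<in> ?P. \<sigma> i = \<tau> i \<and> f \<sigma> \<noteq> f \<tau>}"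
      using split[of "f \<sigma>"] split[of "v (\<sigma> i)"] v(2)[OF SCF_range[OF f \<sigma>], of "\<sigma> i"] by simp
  qed
  also have "\<dots> = card (Sigma ?P (\<lambda>\<sigma>. {\<tau> \<in> ?P. \<sigma> i = \<tau> i \<and> f \<sigma> \<noteq> f \<tau>}))"
    by (simp add: finite_profiles)
  also have "Sigma ?P (\<lambda>\<sigma>. {\<tau> \<in> ?P. \<sigma> i = \<tau> i \<and> f \<sigma> \<noteq> f \<tau>})
      = {(\<sigma>, \<tau>). \<sigma> \<in> ?P \<and> \<tau> \<in> ?P \<and> ?R \<sigma> \<tau> \<and> f \<sigma> \<noteq> f \<tau>}"
    using R by auto
  also have "card \<dots> \<le> m * (\<Sum>j\<in>{1..n}. card (W j))"
    unfolding profiles_def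
  proof (rule resampling_bound; (fold profiles_def)?)
    fix j \<sigma> \<tau>
    assume j: "j \<in> {1..n}" and st: "\<sigma> \<in> ?P" "\<tau> \<in> ?P" and Rst: "?R \<sigma> \<tau>" and ne: "f \<sigma> \<noteq> f (\<sigma>(j := \<tau> j))"
    have "j \<noteq> i" using ne Rst[unfolded R] by (metis fun_upd_triv)
    then have "W j = (\<Union>X\<in>alternative_pairs k. pivot_profiles n k f j X)" by (simp add: W_def)
    then show "\<sigma> \<in> W j"
      using changed_value_pivot[OF f st(1) j profilesD[OF st(2) j] ne] by blast
  qed (use fib R W_sub in \<open>auto simp: finite_rankings\<close>)
  finally have "card {\<sigma> \<in> ?P. f \<sigma> \<noteq> g \<sigma>} \<le> (\<Sum>j\<in>{1..n}. card (W j))" using m by simp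
  also have "\<dots> = (\<Sum>j\<in>{1..n} - {i}. card (W j))"
    using i by (subst sum.remove[of _ i]) (auto simp: W_def)
  also have "\<dots> \<le> (\<Sum>j\<in>{1..n} - {i}. \<Sum>X\<in>alternative_pairs k. card (pivot_profiles n k f j X))"
    using card_UN_pivot_le by (intro sum_mono) (auto simp: W_def)
  finally show ?thesis using D by linarith
qed

text \<open>A walk between profiles on opposite sides of the cut of the values by \<open>S\<close>
  has a step whose two values are separated by \<open>S\<close>; such a pair is never
  \<open>X0\<close>. The factor 2 counts both orders of the two profiles, and the trivial relation
  makes them independent.\<close>

lemma cut_pivots:
  assumes f: "f \<in> SCF n k" and X0: "\<And>x y. x \<in> S \<Longrightarrow> y \<notin> S \<Longrightarrow> {x, y} \<noteq> X0"
  shows "2 * (card {\<sigma> \<in> profiles n k. f \<sigma> \<in> S} * card {\<sigma> \<in> profiles n k. f \<sigma> \<notin> S})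
    \<le> card (profiles n k) * (\<Sum>j\<in>{1..n}. \<Sum>X\<in>alternative_pairs k - {X0}. card (pivot_profiles n k f j X))"
proof -
  let ?P = "profiles n k"
  define I O' where "I = {\<sigma> \<in> ?P. f \<sigma> \<in> S}" and "O' = {\<sigma> \<in> ?P. f \<sigma> \<notin> S}"
  have fin: "finite I" "finite O'" by (auto simp: I_def O'_def finite_profiles)
  define W where "W j = (\<Union>X\<in>alternative_pairs k - {X0}. pivot_profiles n k f j X)" for j
  have W_sub: "W j \<subseteq> ?P" for j using pivot_profiles_subset unfolding W_def by blast
  have "2 * (card I * card O') = card (I \<times> O') + card (O' \<times> I)" by (simp add: card_cartesian_product)
  also have "\<dots> = card (I \<times> O' \<union> O' \<times> I)"
    by (rule card_Un_disjoint[symmetric]) (use fin in \<open>auto simp: I_def O'_def\<close>)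
  also have "I \<times> O' \<union> O' \<times> I = {(\<sigma>, \<tau>). \<sigma> \<in> ?P \<and> \<tau> \<in> ?P \<and> (\<forall>j\<in>{1..n}. True) \<and> (f \<sigma> \<in> S) \<noteq> (f \<tau> \<in> S)}"
    by (auto simp: I_def O'_def)
  also have "card \<dots> \<le> card ?P * (\<Sum>j\<in>{1..n}. card (W j))"
    unfolding profiles_def
  proof (rule resampling_bound; (fold profiles_def)?)
    fix j \<sigma> \<tau>
    assume j: "j \<in> {1..n}" and st: "\<sigma> \<in> ?P" "\<tau> \<in> ?P" and ne: "(f \<sigma> \<in> S) \<noteq> (f (\<sigma>(j := \<tau> j)) \<in> S)"
    then have ne': "f \<sigma> \<noteq> f (\<sigma>(j := \<tau> j))" by auto
    have "{f \<sigma>, f (\<sigma>(j := \<tau> j))} \<noteq> X0" using X0 ne by (metis insert_commute)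
    then show "\<sigma> \<in> W j"
      using changed_value_pivot[OF f st(1) j profilesD[OF st(2) j] ne'] unfolding W_def by blast
  qed (use W_sub in \<open>auto simp: finite_rankings\<close>)
  also have "\<dots> \<le> card ?P * (\<Sum>j\<in>{1..n}. \<Sum>X\<in>alternative_pairs k - {X0}. card (pivot_profiles n k f j X))"
    unfolding W_def by (intro mult_le_mono2 sum_mono card_UN_pivot_le) auto
  finally show ?thesis unfolding I_def O'_def .
qed

text \<open>Choose a cut that does not separate \<open>X0\<close> and has both sides large:
  \<open>S\<close> contains a value of frequency at least \<open>1 / k\<close>, and since
  \<open>S\<close> has at most two elements its complement has frequency at least
  \<open>\<epsilon>\<close>.\<close>

lemma far_from_two_valued_pivots:
  fixes \<epsilon> :: real
  assumes f: "f \<in> SCF n k" and k: "k \<ge> 1" and X0: "X0 \<in> alternative_pairs k" and \<epsilon>: "0 \<le> \<epsilon>" "\<epsilon> \<le> 1"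
    and far: "\<And>a b. a \<in> {1..k} \<Longrightarrow> b \<in> {1..k} \<Longrightarrow>
      \<epsilon> * card (profiles n k) \<le> card {\<sigma> \<in> profiles n k. f \<sigma> \<notin> {a, b}}"
  shows "\<epsilon> * card (profiles n k) / k \<le>
    (\<Sum>j\<in>{1..n}. \<Sum>X\<in>alternative_pairs k - {X0}. card (pivot_profiles n k f j X))"
proof -
  let ?P = "profiles n k"
  define T where "T = real (card ?P)"
  have T: "T > 0" using finite_profiles profiles_nonempty by (simp add: T_def card_gt_0_iff)
  have "\<exists>c\<in>{1..k}. T \<le> k * card {\<sigma> \<in> ?P. f \<sigma> = c}"
  proof (rule ccontr)
    assume *: "\<not> ?thesis"
    have "?P = (\<Union>c\<in>{1..k}. {\<sigma> \<in> ?P. f \<sigma> = c})" using SCF_range[OF f] by auto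
    then have "card ?P \<le> (\<Sum>c\<in>{1..k}. card {\<sigma> \<in> ?P. f \<sigma> = c})"
      using card_UN_le[of "{1..k}" "\<lambda>c. {\<sigma> \<in> ?P. f \<sigma> = c}"] by simp
    then have "T \<le> (\<Sum>c\<in>{1..k}. real (card {\<sigma> \<in> ?P. f \<sigma> = c}))"
      unfolding T_def of_nat_sum[symmetric] of_nat_le_iff .
    also have "\<dots> < (\<Sum>c\<in>{1..k}. T / k)"
      using * k by (intro sum_strict_mono) (auto simp: field_simps not_le)
    also have "\<dots> = T" using k by simp
    finally show False by simp
  qed
  then obtain c where c: "c \<in> {1..k}" "T \<le> k * card {\<sigma> \<in> ?P. f \<sigma> = c}" by auto
  \<comment> \<open>If the popular value \<open>c\<close> belongs to \<open>X0\<close>, the other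
    alternative of \<open>X0\<close> has to join it so that the cut does not separate them.\<close>
  define S where "S = (if c \<in> X0 then X0 else {c})"
  have "c \<in> S" by (simp add: S_def)
  obtain a b where ab: "X0 = {a, b}" using X0 by (auto simp: card_2_iff)
  have cut: "{x, y} \<noteq> X0" if "x \<in> S" "y \<notin> S" for x y
    using that by (auto simp: S_def split: if_splits)
  define s where "s = real (card {\<sigma> \<in> ?P. f \<sigma> \<in> S})"
  have "card {\<sigma> \<in> ?P. f \<sigma> \<in> S} + card {\<sigma> \<in> ?P. f \<sigma> \<notin> S} = card ?P"
    by (subst card_Un_disjoint[symmetric]) (auto simp: finite_profiles intro: arg_cong[where f=card])
  then have t: "real (card {\<sigma> \<in> ?P. f \<sigma> \<notin> S}) = T - s" unfolding T_def s_def by linarith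
  have "real (card {\<sigma> \<in> ?P. f \<sigma> = c}) \<le> s"
    unfolding s_def using \<open>c \<in> S\<close> by (intro of_nat_mono card_mono) (auto simp: finite_profiles)
  then have s: "T \<le> k * s" using c(2) mult_left_mono[of _ s "real k"] by fastforce
  obtain x y where xy: "x \<in> {1..k}" "y \<in> {1..k}" "S = {x, y}"
  proof -
    have "a \<in> {1..k}" "b \<in> {1..k}" using X0 unfolding ab by auto
    moreover have "S = {a, b} \<or> S = {c, c}" by (simp add: S_def ab)
    ultimately show thesis using that c(1) by blast
  qed
  have far': "\<epsilon> * T \<le> T - s"
    using far[OF xy(1,2), folded xy(3)] unfolding t T_def[symmetric] .
  define \<Sigma> where "\<Sigma> = real (\<Sum>j\<in>{1..n}. \<Sum>X\<in>alternative_pairs k - {X0}. card (pivot_profiles n k f j X))"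
  have "real (2 * (card {\<sigma> \<in> ?P. f \<sigma> \<in> S} * card {\<sigma> \<in> ?P. f \<sigma> \<notin> S})) \<le>
      real (card ?P * (\<Sum>j\<in>{1..n}. \<Sum>X\<in>alternative_pairs k - {X0}. card (pivot_profiles n k f j X)))"
    using cut_pivots[OF f cut] by (rule of_nat_mono)
  then have key: "2 * (s * (T - s)) \<le> T * \<Sigma>"
    unfolding of_nat_mult t s_def[symmetric] T_def[symmetric] \<Sigma>_def[symmetric] by simp
  have s0: "s \<ge> 0" "T - s \<ge> 0" unfolding t[symmetric] by (simp_all add: s_def)
  have k1: "real k \<ge> 1" using k by simp
  \<comment> \<open>One of \<open>s\<close> and \<open>T - s\<close> is at least
    \<open>T / 2\<close>. If \<open>s\<close> is, then \<open>T - s \<ge> \<epsilon> * T\<close>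
    suffices; otherwise \<open>s \<ge> T / k\<close> and \<open>\<epsilon> \<le> 1\<close>
    do.\<close>
  have "T * (\<epsilon> * T / k) \<le> T * \<Sigma>"
  proof (cases "T \<le> 2 * s")
    case True
    have "T * (\<epsilon> * T / k) \<le> T * (\<epsilon> * T)"
      using T \<epsilon> k1 divide_left_mono[of 1 "real k" "\<epsilon> * T"] by (intro mult_left_mono) auto
    also have "\<dots> \<le> (2 * s) * (T - s)" using True far' s0 \<epsilon> T by (intro mult_mono) auto
    finally show ?thesis using key by simp
  next
    case False
    have "T * (\<epsilon> * T / k) \<le> T * (T / k)"
      using T \<epsilon> k1 by (intro mult_left_mono divide_right_mono) (auto intro: mult_left_le_one_le)
    also have "\<dots> \<le> (2 * (T - s)) * s"
      using False s s0 T k1 by (intro mult_mono) (auto simp: field_simps)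
    finally show ?thesis using key by (simp add: algebra_simps)
  qed
  then have "\<epsilon> * T / k \<le> \<Sigma>" using T by (rule mult_left_le_imp_le)
  then show ?thesis unfolding \<Sigma>_def T_def .
qed

section \<open>Averaging and the numerical estimate\<close>

lemma exists_large_pivot:
  fixes D :: real and n k :: nat and u :: "nat \<Rightarrow> nat set \<Rightarrow> real"
  assumes n: "n \<ge> 1" and k: "k \<ge> 2" and D: "D > 0" "D / k \<le> (\<Sum>j\<in>J. \<Sum>X\<in>Q. u j X)"
    and J: "J \<subseteq> {1..n}" and Q: "Q \<subseteq> alternative_pairs k"
  shows "\<exists>j\<in>J. \<exists>X\<in>Q. 2 * D / (n * k ^ 3) \<le> u j X"
proof (rule ccontr)
  define \<theta> where "\<theta> = 2 * D / (n * k ^ 3)"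
  have \<theta>: "\<theta> > 0" using D n k by (simp add: \<theta>_def)
  assume "\<not> (\<exists>j\<in>J. \<exists>X\<in>Q. 2 * D / (n * k ^ 3) \<le> u j X)"
  then have less: "u j X \<le> \<theta>" if "j \<in> J" "X \<in> Q" for j X using that unfolding \<theta>_def by (meson linear)
  have "D / k \<le> (\<Sum>j\<in>J. \<Sum>X\<in>Q. \<theta>)"
    using D(2) by (rule order_trans) (intro sum_mono less)
  also have "\<dots> = card J * (card Q * \<theta>)" by simp
  also have "\<dots> \<le> n * (real (k choose 2) * \<theta>)"
  proof (intro mult_mono mult_right_mono of_nat_mono)
    show "card J \<le> n" using card_mono[OF _ J] by simp
    show "card Q \<le> k choose 2"
      using card_mono[OF finite_alternative_pairs Q] n_subsets[of "{1..k}" 2] by simp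
  qed (use \<theta> in auto)
  also have "\<dots> = n * (real k * (real k - 1) / 2 * \<theta>)"
  proof -
    have "even (k * (k - 1))" by auto
    then have "2 * (k choose 2) = k * (k - 1)" unfolding choose_two by (rule dvd_mult_div_cancel)
    then have "real (2 * (k choose 2)) = real (k * (k - 1))" by (rule arg_cong)
    then have "2 * real (k choose 2) = real k * (real k - 1)" using k by (simp add: of_nat_diff)
    then show ?thesis by simp
  qed
  \<comment> \<open>Strictness comes from \<open>k - 1 < k\<close>, and it turns the number of pairs
    into the \<open>k ^ 2 / 2\<close> for which \<open>\<theta>\<close> was chosen.\<close>
  also have "\<dots> < n * (real k * real k / 2 * \<theta>)"
    using \<theta> n k by (intro mult_strict_left_mono mult_strict_right_mono) auto
  also have "\<dots> = D / k" using n k by (simp add: \<theta>_def field_simps power3_eq_cube)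
  finally show False by simp
qed

text \<open>Let \<open>e\<close> be half of the pivot threshold. If the rounding loss is at most
  \<open>e\<close>, the hypothesis keeps at least \<open>e ^ 4\<close> on its left side; if not,
  \<open>\<delta>\<close> is already large and \<open>e ^ 4 \<le> e\<close> is enough.\<close>

lemma final_estimate:
  fixes \<epsilon> \<delta> N F :: real and n k :: nat
  assumes n: "n \<ge> 2" and k: "k \<ge> 1" and \<epsilon>: "0 < \<epsilon>" "\<epsilon> \<le> 1" and N: "1 \<le> N" "N \<le> F" and \<delta>: "\<delta> \<ge> 0"
    and bound: "2 * n * (N ^ 2 * \<delta>) \<le> 2 * \<epsilon> / (n * k ^ 3) \<Longrightarrow>
      (2 * \<epsilon> / (n * k ^ 3) - 2 * n * (N ^ 2 * \<delta>)) ^ 4 \<le> (4 * n + 1) * (N ^ 2 * \<delta>)"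
  shows "\<epsilon> ^ 5 / (4 * real n ^ 7 * real k ^ 12 * F ^ 4) \<le> \<delta>"
proof -
  define e where "e = \<epsilon> / (n * k ^ 3)"
  have nk: "1 \<le> real n * real k ^ 3"
    using n k by (intro order_trans[OF _ mult_mono[of 1 "real n" 1 "real k ^ 3"]]) auto
  have e: "0 < e" "e \<le> 1" using nk \<epsilon> by (auto simp: e_def divide_le_eq)
  have x: "N ^ 2 * \<delta> \<ge> 0" using \<delta> by simp
  have e4: "e ^ 4 \<le> (4 * n + 1) * (N ^ 2 * \<delta>)"
  proof (cases "2 * n * (N ^ 2 * \<delta>) \<le> e")
    case True
    have eq: "2 * \<epsilon> / (n * k ^ 3) = 2 * e" by (simp add: e_def)
    have small: "2 * n * (N ^ 2 * \<delta>) \<le> 2 * \<epsilon> / (n * k ^ 3)" unfolding eq using True e by linarith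
    have "e ^ 4 \<le> (2 * e - 2 * n * (N ^ 2 * \<delta>)) ^ 4" using True e by (intro power_mono) auto
    then show ?thesis using bound[OF small] unfolding eq by linarith
  next
    case False
    have "e ^ 4 \<le> e ^ 1" using e by (intro power_decreasing) auto
    also have "\<dots> \<le> 2 * n * (N ^ 2 * \<delta>)" using False by simp
    also have "\<dots> \<le> (4 * n + 1) * (N ^ 2 * \<delta>)" using x by (intro mult_right_mono) auto
    finally show ?thesis .
  qed
  have F: "F \<ge> 1" using N by linarith
  have "\<epsilon> ^ 5 / (4 * real n ^ 7 * real k ^ 12 * F ^ 4) = e ^ 4 * (\<epsilon> / (4 * real n ^ 3 * F ^ 4))"
  proof -
    have "e ^ 4 = \<epsilon> ^ 4 / (real n ^ 4 * real k ^ 12)"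
      by (simp add: e_def power_divide power_mult_distrib flip: power_mult)
    moreover have "\<epsilon> ^ 5 = \<epsilon> ^ 4 * \<epsilon>" "real n ^ 7 = real n ^ 4 * real n ^ 3"
      by (simp_all add: power_add[symmetric] power_Suc2[symmetric] del: power_Suc)
    ultimately show ?thesis by (simp add: mult_ac)
  qed
  \<comment> \<open>The fifth factor \<open>\<epsilon>\<close> is bounded by 1 here; the other four
    sit in \<open>e ^ 4\<close>.\<close>
  also have "\<dots> \<le> ((4 * n + 1) * (N ^ 2 * \<delta>)) * (1 / (4 * real n ^ 3 * F ^ 4))"
    using e4 e \<epsilon> F x by (intro mult_mono divide_right_mono) auto
  also have "\<dots> = \<delta> * (((4 * n + 1) * N ^ 2) / (4 * real n ^ 3 * F ^ 4))" by simp
  also have "\<dots> \<le> \<delta> * 1"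
  proof (rule mult_left_mono[OF _ \<delta>])
    \<comment> \<open>The assumption \<open>n \<ge> 2\<close> lets \<open>4 * n ^ 3\<close> absorb
      \<open>4 * n + 1\<close>.\<close>
    have "real n * 4 \<le> real n * (real n)\<^sup>2" using n power_mono[of 2 "real n" 2] by (intro mult_left_mono) auto
    moreover have "real n ^ 3 = real n * (real n)\<^sup>2" by (simp add: power3_eq_cube power2_eq_square)
    moreover have "real n \<ge> 2" using n by simp
    ultimately have "4 * real n + 1 \<le> 4 * real n ^ 3" by linarith
    moreover have "N ^ 2 \<le> F ^ 4"
      using N F power_mono[of N F 2] power_increasing[of 2 4 F] by linarith
    ultimately have "(4 * n + 1) * N ^ 2 \<le> 4 * real n ^ 3 * F ^ 4" by (intro mult_mono) auto
    then show "((4 * n + 1) * N ^ 2) / (4 * real n ^ 3 * F ^ 4) \<le> 1"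
      using n F by (subst divide_le_eq_1_pos) auto
  qed
  finally show ?thesis by simp
qed

section \<open>From probabilities to counts\<close>

lemma prob_uniform_profile:
  "measure_pmf.prob (uniform_profile n k) S = card (profiles n k \<inter> S) / card (profiles n k)"
  unfolding uniform_profile_def by (rule measure_pmf_of_set[OF profiles_nonempty finite_profiles])

lemma pair_pmf_of_set:
  assumes "finite A" "A \<noteq> {}" "finite B" "B \<noteq> {}"
  shows "pair_pmf (pmf_of_set A) (pmf_of_set B) = pmf_of_set (A \<times> B)"
proof (rule pmf_eqI)
  fix x
  show "pmf (pair_pmf (pmf_of_set A) (pmf_of_set B)) x = pmf (pmf_of_set (A \<times> B)) x"
    using assms by (cases x) (simp add: pmf_pair indicator_def)
qed

text \<open>The random choices form a uniform triple of profile, voter and ranking. Fixing one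
  successful voter and ranking for each manipulation point gives that many favourable
  triples.\<close>

lemma rerandomized_manipulation:
  assumes n: "n \<ge> 1"
  shows "card (manipulation_points n k f) / (card (profiles n k) * n * card (rankings k))
    \<le> measure_pmf.prob (rerandomized_pair n k) {(\<sigma>, \<sigma>'). manipulation_pair n k f \<sigma> \<sigma>'}"
proof -
  let ?S = "profiles n k \<times> {1..n} \<times> rankings k"
  let ?h = "\<lambda>(\<sigma> :: nat \<Rightarrow> nat rel, i, r). (\<sigma>, \<sigma>(i := r))"
  let ?Q = "{(\<sigma>, \<sigma>'). manipulation_pair n k f \<sigma> \<sigma>'}"
  have ne: "{1..n} \<noteq> {}" using n by simp
  have "rerandomized_pair n k = map_pmf ?h (pair_pmf (pmf_of_set (profiles n k))
      (pair_pmf (pmf_of_set {1..n}) (pmf_of_set (rankings k))))"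
    by (simp add: rerandomized_pair_def uniform_profile_def map_pmf_def pair_pmf_def bind_assoc_pmf bind_return_pmf)
  also have "\<dots> = map_pmf ?h (pmf_of_set ?S)"
    using ne by (simp add: pair_pmf_of_set finite_profiles profiles_nonempty finite_rankings rankings_nonempty)
  finally have "measure_pmf.prob (rerandomized_pair n k) ?Q = card (?S \<inter> ?h -` ?Q) / card ?S"
    using ne by (simp only: measure_map_pmf)
      (rule measure_pmf_of_set; auto simp: finite_profiles profiles_nonempty finite_rankings rankings_nonempty)
  moreover have "card (manipulation_points n k f) \<le> card (?S \<inter> ?h -` ?Q)"
  proof -
    have "\<exists>i r. i \<in> {1..n} \<and> r \<in> rankings k \<and> manipulation_pair n k f \<sigma> (\<sigma>(i := r))"
      if \<sigma>: "\<sigma> \<in> manipulation_points n k f" for \<sigma>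
    proof -
      from \<sigma> obtain \<sigma>' where "manipulation_pair n k f \<sigma> \<sigma>'" by (auto simp: manipulation_points_def)
      moreover from this obtain i where "i \<in> {1..n}" "\<forall>j\<in>{1..n}. \<sigma> j \<noteq> \<sigma>' j \<longleftrightarrow> j = i"
        unfolding manipulation_pair_def by blast
      ultimately have s: "manipulation_pair n k f \<sigma> \<sigma>'" "i \<in> {1..n}" "\<forall>j\<in>{1..n}. \<sigma> j \<noteq> \<sigma>' j \<longleftrightarrow> j = i" .
      have P: "\<sigma> \<in> profiles n k" "\<sigma>' \<in> profiles n k" using s(1) by (auto simp: manipulation_pair_def)
      \<comment> \<open>Agreement off \<open>{1..n}\<close> holds because both profiles are
        extensional.\<close>
      have "\<sigma>' = \<sigma>(i := \<sigma>' i)"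
      proof
        fix j show "\<sigma>' j = (\<sigma>(i := \<sigma>' i)) j"
          using s(2,3) P by (cases "j \<in> {1..n}") (auto simp: profiles_def PiE_iff extensional_def)
      qed
      then show ?thesis using s(1,2) profilesD[OF P(2) s(2)] by metis
    qed
    then obtain i r where ir: "\<And>\<sigma>. \<sigma> \<in> manipulation_points n k f \<Longrightarrow>
        i \<sigma> \<in> {1..n} \<and> r \<sigma> \<in> rankings k \<and> manipulation_pair n k f \<sigma> (\<sigma>(i \<sigma> := r \<sigma>))" by metis
    show ?thesis
    proof (rule card_inj_on_le[where f = "\<lambda>\<sigma>. (\<sigma>, i \<sigma>, r \<sigma>)"])
      show "(\<lambda>\<sigma>. (\<sigma>, i \<sigma>, r \<sigma>)) ` manipulation_points n k f \<subseteq> ?S \<inter> ?h -` ?Q"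
        using ir manipulation_points_subset by fastforce
    qed (auto simp: inj_on_def finite_profiles finite_rankings)
  qed
  ultimately show ?thesis
    by (simp add: card_cartesian_product divide_right_mono mult.assoc)
qed

lemma SCF_dist_set_lower_bound:
  assumes "\<epsilon> \<le> SCF_dist_set n k f G" "finite G" "g \<in> G"
  shows "\<epsilon> * card (profiles n k) \<le> card {\<sigma> \<in> profiles n k. f \<sigma> \<noteq> g \<sigma>}"
proof -
  have "\<epsilon> \<le> SCF_dist n k f g"
    using assms unfolding SCF_dist_set_def by (meson Min_le finite_imageI imageI order_trans)
  also have "\<dots> = card (profiles n k \<inter> {\<sigma>. f \<sigma> \<noteq> g \<sigma>}) / card (profiles n k)"
    by (simp add: SCF_dist_def prob_uniform_profile)
  also have "profiles n k \<inter> {\<sigma>. f \<sigma> \<noteq> g \<sigma>} = {\<sigma> \<in> profiles n k. f \<sigma> \<noteq> g \<sigma>}" by auto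
  finally show ?thesis using finite_profiles profiles_nonempty
    by (simp add: field_simps card_gt_0_iff)
qed

lemma far_from_two_valued:
  assumes f: "f \<in> SCF n k" and ab: "a \<in> {1..k}" "b \<in> {1..k}"
    and far: "\<And>g. g \<in> NONMANIP_bar n k \<Longrightarrow> (D :: real) \<le> card {\<sigma> \<in> profiles n k. f \<sigma> \<noteq> g \<sigma>}"
  shows "D \<le> card {\<sigma> \<in> profiles n k. f \<sigma> \<notin> {a, b}}"
proof -
  \<comment> \<open>Sending all other values to \<open>a\<close> makes \<open>f\<close> two-valued
    and changes it only where it leaves \<open>{a, b}\<close>.\<close>
  define g where "g = (\<lambda>\<sigma>\<in>profiles n k. if f \<sigma> \<in> {a, b} then f \<sigma> else a)"
  have "card (g ` profiles n k) \<le> card {a, b}" by (rule card_mono) (auto simp: g_def)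
  also have "\<dots> \<le> 2" by (simp add: card_insert_if)
  finally have "g \<in> NONMANIP_bar n k" using ab by (auto simp: NONMANIP_bar_def SCF_def g_def)
  note far[OF this]
  also have "{\<sigma> \<in> profiles n k. f \<sigma> \<noteq> g \<sigma>} \<subseteq> {\<sigma> \<in> profiles n k. f \<sigma> \<notin> {a, b}}" by (auto simp: g_def)
  then have "real (card {\<sigma> \<in> profiles n k. f \<sigma> \<noteq> g \<sigma>}) \<le> card {\<sigma> \<in> profiles n k. f \<sigma> \<notin> {a, b}}"
    by (intro of_nat_mono card_mono) (auto simp: finite_profiles)
  finally show ?thesis .
qed

section \<open>Two large pivotal sets and the final bound\<close>

lemma large_pivot_other_voter:
  fixes D :: real
  assumes f: "f \<in> SCF n k" and i: "i \<in> {1..n}" and k: "k \<ge> 2" and D: "D > 0"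
    and far: "\<And>g. g \<in> NONMANIP_bar n k \<Longrightarrow> D \<le> card {\<sigma> \<in> profiles n k. f \<sigma> \<noteq> g \<sigma>}"
  shows "\<exists>j\<in>{1..n} - {i}. \<exists>X\<in>alternative_pairs k. 2 * D / (n * k ^ 3) \<le> card (pivot_profiles n k f j X)"
proof (rule exists_large_pivot[where u = "\<lambda>j X. real (card (pivot_profiles n k f j X))"])
  \<comment> \<open>The distance counts are integers, so \<open>D\<close> may be rounded up.\<close>
  have "nat \<lceil>D\<rceil> \<le> (\<Sum>j\<in>{1..n} - {i}. \<Sum>X\<in>alternative_pairs k. card (pivot_profiles n k f j X))"
    using far k by (intro far_from_dictator_pivots[OF f i])
      (auto simp: NONMANIP_bar_def nat_le_iff ceiling_le_iff)
  then have "D \<le> real (\<Sum>j\<in>{1..n} - {i}. \<Sum>X\<in>alternative_pairs k. card (pivot_profiles n k f j X))"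
    unfolding nat_le_iff ceiling_le_iff by simp
  \<comment> \<open>The division by \<open>k\<close> makes the threshold agree with that of
    \<open>large_pivot_other_pair\<close>.\<close>
  moreover have "D / k \<le> D" using D k by (simp add: divide_le_eq)
  ultimately show "D / k \<le> (\<Sum>j\<in>{1..n} - {i}. \<Sum>X\<in>alternative_pairs k. real (card (pivot_profiles n k f j X)))"
    by simp
qed (use i k D in auto)

lemma large_pivot_other_pair:
  fixes \<epsilon> :: real
  assumes f: "f \<in> SCF n k" and n: "n \<ge> 1" and k: "k \<ge> 2" and \<epsilon>: "0 < \<epsilon>" "\<epsilon> \<le> 1" and X0: "X0 \<in> alternative_pairs k"
    and far: "\<And>a b. a \<in> {1..k} \<Longrightarrow> b \<in> {1..k} \<Longrightarrow>
      \<epsilon> * card (profiles n k) \<le> card {\<sigma> \<in> profiles n k. f \<sigma> \<notin> {a, b}}"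
  shows "\<exists>j\<in>{1..n}. \<exists>X\<in>alternative_pairs k - {X0}.
    2 * (\<epsilon> * card (profiles n k)) / (n * k ^ 3) \<le> card (pivot_profiles n k f j X)"
proof (rule exists_large_pivot[where u = "\<lambda>j X. real (card (pivot_profiles n k f j X))"])
  show "\<epsilon> * card (profiles n k) / k
      \<le> (\<Sum>j\<in>{1..n}. \<Sum>X\<in>alternative_pairs k - {X0}. real (card (pivot_profiles n k f j X)))"
    using far_from_two_valued_pivots[OF f _ X0 _ \<epsilon>(2) far] k \<epsilon>(1) by simp
  show "0 < \<epsilon> * card (profiles n k)"
    using \<epsilon>(1) finite_profiles profiles_nonempty by (simp add: card_gt_0_iff)
qed (use n k in auto)

lemma two_large_pivots:
  fixes \<theta> :: real
  assumes n: "n \<ge> 1"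
    and voter: "\<And>i. i \<in> {1..n} \<Longrightarrow>
      \<exists>j\<in>{1..n} - {i}. \<exists>X\<in>alternative_pairs k. \<theta> \<le> card (pivot_profiles n k f j X)"
    and pair: "\<And>X0. X0 \<in> alternative_pairs k \<Longrightarrow>
      \<exists>j\<in>{1..n}. \<exists>X\<in>alternative_pairs k - {X0}. \<theta> \<le> card (pivot_profiles n k f j X)"
  shows "\<exists>i j X Y. i \<in> {1..n} \<and> j \<in> {1..n} \<and> i \<noteq> j \<and> X \<in> alternative_pairs k \<and> Y \<in> alternative_pairs k \<and> X \<noteq> Y \<and>
    \<theta> \<le> card (pivot_profiles n k f i X) \<and> \<theta> \<le> card (pivot_profiles n k f j Y)"
proof -
  have "1 \<in> {1..n}" using n by simp
  from voter[OF this] obtain i X where i: "i \<in> {1..n}" "X \<in> alternative_pairs k" "\<theta> \<le> card (pivot_profiles n k f i X)"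
    by blast
  from voter[OF i(1)] obtain j Y where j: "j \<in> {1..n}" "j \<noteq> i" "Y \<in> alternative_pairs k" "\<theta> \<le> card (pivot_profiles n k f j Y)"
    by blast
  from pair[OF i(2)] obtain l Z where l: "l \<in> {1..n}" "Z \<in> alternative_pairs k" "Z \<noteq> X" "\<theta> \<le> card (pivot_profiles n k f l Z)"
    by blast
  have witness: ?thesis
    if "i \<in> {1..n}" "j \<in> {1..n}" "i \<noteq> j" "X \<in> alternative_pairs k" "Y \<in> alternative_pairs k" "X \<noteq> Y"
      "\<theta> \<le> card (pivot_profiles n k f i X)" "\<theta> \<le> card (pivot_profiles n k f j Y)" for i j X Y
    by (intro exI conjI) (rule that)+
  \<comment> \<open>If \<open>i\<close> and \<open>j\<close> share the pair \<open>X\<close>, the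
    voter \<open>l\<close> with another pair \<open>Z\<close> differs from at least one of
    them.\<close>
  consider "Y \<noteq> X" | "Y = X" "l \<noteq> i" | "Y = X" "l \<noteq> j" using j(2) by blast
  then show ?thesis
  proof cases
    case 1
    show ?thesis by (rule witness[OF i(1) j(1) j(2)[symmetric] i(2) j(3) 1[symmetric] i(3) j(4)])
  next
    case 2
    show ?thesis by (rule witness[OF i(1) l(1) 2(2)[symmetric] i(2) l(2) l(3)[symmetric] i(3) l(4)])
  next
    case 3
    show ?thesis by (rule witness[OF j(1) l(1) 3(2)[symmetric] j(3) l(2) _ j(4) l(4)]) (use 3 l(3) in simp)
  qed
qed

lemma manipulation_points_lower_bound:
  fixes \<epsilon> :: real
  assumes n: "n \<ge> 2" and k: "k \<ge> 3" and \<epsilon>: "\<epsilon> > 0" and f: "f \<in> SCF n k"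
    and far: "\<And>g. g \<in> NONMANIP_bar n k \<Longrightarrow>
      \<epsilon> * card (profiles n k) \<le> card {\<sigma> \<in> profiles n k. f \<sigma> \<noteq> g \<sigma>}"
  shows "\<epsilon> ^ 5 / (4 * real n ^ 7 * real k ^ 12 * (fact k) ^ 4)
    \<le> card (manipulation_points n k f) / card (profiles n k)"
proof -
  define T where "T = real (card (profiles n k))"
  define N where "N = real (card (rankings k))"
  define M where "M = real (card (manipulation_points n k f))"
  define \<delta> where "\<delta> = M / T"
  define \<theta> where "\<theta> = 2 * (\<epsilon> * T) / (n * k ^ 3)"
  have T: "T > 0" using finite_profiles profiles_nonempty by (simp add: T_def card_gt_0_iff)
  note far_two = far_from_two_valued[OF f _ _ far]
  \<comment> \<open>Obtained from the distance to constant functions, as the case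
    \<open>a = b = 1\<close>.\<close>
  have \<epsilon>1: "\<epsilon> \<le> 1"
  proof -
    have "\<epsilon> * T \<le> card {\<sigma> \<in> profiles n k. f \<sigma> \<notin> {1, 1}}" using far_two[of 1 1] k by (simp add: T_def)
    also have "\<dots> \<le> T" unfolding T_def by (intro of_nat_mono card_mono) (auto simp: finite_profiles)
    finally show ?thesis using T by simp
  qed
  have "\<exists>i j X Y. i \<in> {1..n} \<and> j \<in> {1..n} \<and> i \<noteq> j \<and> X \<in> alternative_pairs k \<and> Y \<in> alternative_pairs k \<and> X \<noteq> Y \<and>
    \<theta> \<le> card (pivot_profiles n k f i X) \<and> \<theta> \<le> card (pivot_profiles n k f j Y)"
  proof (rule two_large_pivots)
    show "\<exists>j\<in>{1..n} - {i}. \<exists>X\<in>alternative_pairs k. \<theta> \<le> card (pivot_profiles n k f j X)"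
      if "i \<in> {1..n}" for i
      unfolding \<theta>_def T_def
      by (rule large_pivot_other_voter[OF f that _ _ far]) (use k \<epsilon> T in \<open>auto simp: T_def\<close>)
    show "\<exists>j\<in>{1..n}. \<exists>X\<in>alternative_pairs k - {X0}. \<theta> \<le> card (pivot_profiles n k f j X)"
      if "X0 \<in> alternative_pairs k" for X0
      unfolding \<theta>_def T_def
      by (rule large_pivot_other_pair[OF f _ _ \<epsilon> \<epsilon>1 that far_two]) (use n k in auto)
  qed (use n in simp)
  then obtain i j X Y where ij: "i \<in> {1..n}" "j \<in> {1..n}" "i \<noteq> j"
    and XY: "X \<in> alternative_pairs k" "Y \<in> alternative_pairs k" "X \<noteq> Y"
    and large: "\<theta> \<le> card (pivot_profiles n k f i X)" "\<theta> \<le> card (pivot_profiles n k f j Y)"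
    by blast
  have N: "1 \<le> N" "N \<le> fact k"
    using card_rankings_pos[of k] of_nat_mono[OF card_rankings_le_fact[of k], where 'a = real]
    by (simp_all add: N_def Suc_le_eq)
  have "\<epsilon> ^ 5 / (4 * real n ^ 7 * real k ^ 12 * (fact k) ^ 4) \<le> \<delta>"
  proof (rule final_estimate[OF n _ \<epsilon> \<epsilon>1 N])
    assume small: "2 * n * (N ^ 2 * \<delta>) \<le> 2 * \<epsilon> / (n * k ^ 3)"
    \<comment> \<open>Dividing by the number \<open>T\<close> of profiles turns counts into
      frequencies; the fourth power accounts for the \<open>T ^ 4\<close> cancelled below.\<close>
    have scale: "\<theta> - 2 * real n * (N\<^sup>2 * M) = T * (2 * \<epsilon> / (n * k ^ 3) - 2 * n * (N ^ 2 * \<delta>))"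
      using T by (simp add: \<theta>_def \<delta>_def algebra_simps)
    have "(\<theta> - 2 * real n * (N\<^sup>2 * M)) ^ 4 \<le> (4 * real n + 1) * (N\<^sup>2 * M) * T ^ 3"
      unfolding T_def
    proof (rule two_pivots_force_manipulation[OF f ij _ _ _ _ XY(3) large])
      have "\<theta> - 2 * real n * (N\<^sup>2 * M) \<ge> 0" unfolding scale using T small by simp
      then show "2 * real n * (N\<^sup>2 * M) \<le> \<theta>" by simp
    qed (use XY in \<open>auto simp: N_def M_def\<close>)
    moreover have "(4 * real n + 1) * (N\<^sup>2 * M) * T ^ 3 = T ^ 4 * ((4 * n + 1) * (N ^ 2 * \<delta>))"
      using T by (simp add: \<delta>_def power4_eq_xxxx power3_eq_cube)
    ultimately have "T ^ 4 * (2 * \<epsilon> / (n * k ^ 3) - 2 * n * (N ^ 2 * \<delta>)) ^ 4 \<le> T ^ 4 * ((4 * n + 1) * (N ^ 2 * \<delta>))"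
      unfolding scale power_mult_distrib by simp
    then show "(2 * \<epsilon> / (n * k ^ 3) - 2 * n * (N ^ 2 * \<delta>)) ^ 4 \<le> (4 * n + 1) * (N ^ 2 * \<delta>)"
      using T by simp
  qed (use k T in \<open>auto simp: \<delta>_def M_def\<close>)
  then show ?thesis by (simp add: \<delta>_def M_def T_def)
qed

theorem theorem3p1:
  fixes n k :: nat and \<epsilon> :: real and f :: "(nat \<Rightarrow> nat rel) \<Rightarrow> nat"
  assumes "n \<ge> 2" and "k \<ge> 3" and "\<epsilon> > 0"
    and "f \<in> SCF n k"
    and "SCF_dist_set n k f (NONMANIP_bar n k) \<ge> \<epsilon>"
  shows "measure_pmf.prob (uniform_profile n k) (manipulation_points n k f)
           \<ge> \<epsilon> ^ 5 / (4 * real n ^ 7 * real k ^ 12 * (fact k) ^ 4)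
       \<and> measure_pmf.prob (rerandomized_pair n k) {(\<sigma>, \<sigma>'). manipulation_pair n k f \<sigma> \<sigma>'}
           \<ge> \<epsilon> ^ 5 / (4 * real n ^ 8 * real k ^ 12 * (fact k) ^ 5)"
proof -
  let ?m = "card (manipulation_points n k f) / card (profiles n k)"
  have main: "\<epsilon> ^ 5 / (4 * real n ^ 7 * real k ^ 12 * (fact k) ^ 4) \<le> ?m"
    using assms SCF_dist_set_lower_bound[OF assms(5) finite_NONMANIP_bar]
    by (intro manipulation_points_lower_bound)
  \<comment> \<open>The second bound is the first one times the chance of hitting one fixed
    successful voter and ranking, with \<open>card (rankings k)\<close> at most
    \<open>fact k\<close>.\<close>
  have "\<epsilon> ^ 5 / (4 * real n ^ 8 * real k ^ 12 * (fact k) ^ 5)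
      = \<epsilon> ^ 5 / (4 * real n ^ 7 * real k ^ 12 * (fact k) ^ 4) / (real n * fact k)"
    by (simp add: eval_nat_numeral mult_ac)
  also have "\<dots> \<le> ?m / (real n * real (card (rankings k)))"
  proof (rule frac_le)
    show "0 < real n * real (card (rankings k))" using assms(1) card_rankings_pos[of k] by simp
    show "real n * real (card (rankings k)) \<le> real n * fact k"
      using of_nat_mono[OF card_rankings_le_fact[of k], where 'a = real] by (simp add: mult_left_mono)
  qed (use main in simp_all)
  also have "\<dots> = card (manipulation_points n k f) / (card (profiles n k) * n * card (rankings k))"
    by (simp add: mult.assoc)
  also have "\<dots> \<le> measure_pmf.prob (rerandomized_pair n k) {(\<sigma>, \<sigma>'). manipulation_pair n k f \<sigma> \<sigma>'}"
    using assms(1) by (intro rerandomized_manipulation) simp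
  finally show ?thesis
    using main manipulation_points_subset[of n k f] by (simp add: prob_uniform_profile Int_absorb1)
qed

end
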